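(* Let $0<p<1$. There exist positive numbers $c_p$ and $C_p$ (depending only on $p$) such that for every integer $n\ge 1$, $$c_p\,n^{1/p-1}\le\|\chi_n\|_{\mathfrak M_p}=\|\Delta_n\|_{\mathfrak M_p}\le C_p\,n^{1/p-1}.$$
   Context: For $p>0$, $\boldsymbol S_p$ is the Schatten--von Neumann class, with $\|T\|_{\boldsymbol S_p}=\big(\sum_{j\ge0}s_j(T)^p\big)^{1/p}$, where $s_j(T)$ are the singular values of $T$. Infinite matrices indexed by $j,k\ge0$ are identified with operators on $\ell^2$, and $n\times n$ matrices with operators on $\mathbb C^n$. The Schur--Hadamard product of two matrices $A=\{a_{jk}\}$ and $B=\{b_{jk}\}$ of the same size (finite or infinite) is $A\star B=\{a_{jk}b_{jk}\}$. The Schur multiplier $p$-norm of a matrix $A$ is $$\|A\|_{\mathfrak M_p}=\sup\{\|A\star B\|_{\boldsymbol S_p}:\ B\in\boldsymbol S_p,\ \|B\|_{\boldsymbol S_p}\le1\},$$ where $B$ ranges over matrices of the same size as $A$. $\chi_n$ is the $n\times n$ matrix with entries $(\chi_n)_{jk}=1$ if $j\le k$ and $(\chi_n)_{jk}=0$ if $j>k$, $1\le j,k\le n$. Thus $\|\chi_n\|_{\mathfrak M_p}$ is the $p$-norm, as an operator on $n\times n$ matrices with the $\boldsymbol S_p$ quasinorm, of the upper triangular projection $A\mapsto\chi_n\star A$. $\Delta_n=\{(\Delta_n)_{jk}\}_{j,k\ge0}$ is the infinite Hankel matrix with $(\Delta_n)_{jk}=1$ if $j+k<n$ and $(\Delta_n)_{jk}=0$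 if $j+k\ge n$. *)

theory Defs
  imports "HOL-Analysis.Analysis"
begin

text \<open>
  A matrix is a function of its row and column index. The index set \<open>I\<close> is passed separately
  (\<open>{1..n}\<close> for \<open>n \<times> n\<close> matrices, \<open>UNIV\<close> for infinite ones); entries outside \<open>I \<times> I\<close> are never
  looked at. Vectors of \<open>\<ell>\<^sup>2(I)\<close> are extended by zero.
\<close>

type_synonym 'i cmatrix = "'i \<Rightarrow> 'i \<Rightarrow> complex"

definition ell2 :: "'i set \<Rightarrow> ('i \<Rightarrow> complex) set" where
  "ell2 I = {x. (\<forall>i. i \<notin> I \<longrightarrow> x i = 0) \<and> (\<lambda>i. (cmod (x i))\<^sup>2) summable_on I}"

definition ell2_norm :: "'i set \<Rightarrow> ('i \<Rightarrow> complex) \<Rightarrow> real" where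
  "ell2_norm I x = sqrt (\<Sum>\<^sub>\<infinity>i\<in>I. (cmod (x i))\<^sup>2)"

definition mat_app :: "'i set \<Rightarrow> 'i cmatrix \<Rightarrow> ('i \<Rightarrow> complex) \<Rightarrow> ('i \<Rightarrow> complex)" where
  "mat_app I A x = (\<lambda>j. if j \<in> I then (\<Sum>\<^sub>\<infinity>k\<in>I. A j k * x k) else 0)"

definition bounded_mat :: "'i set \<Rightarrow> 'i cmatrix \<Rightarrow> bool" where
  "bounded_mat I A \<longleftrightarrow> (\<exists>C. \<forall>x\<in>ell2 I.
     (\<forall>j\<in>I. (\<lambda>k. A j k * x k) summable_on I) \<and>
     mat_app I A x \<in> ell2 I \<and> ell2_norm I (mat_app I A x) \<le> C * ell2_norm I x)"

text \<open>Meaningful for bounded matrices only; \<open>Sup\<close> is the real supremum.\<close>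

definition op_norm :: "'i set \<Rightarrow> 'i cmatrix \<Rightarrow> real" where
  "op_norm I A = Sup {ell2_norm I (mat_app I A x) | x. x \<in> ell2 I \<and> ell2_norm I x \<le> 1}"

text \<open>
  \<open>rank A \<le> r\<close>: the range is contained in the complex linear span of \<open>r\<close> (not necessarily distinct
  or independent) vectors.
\<close>

definition rank_le :: "'i set \<Rightarrow> 'i cmatrix \<Rightarrow> nat \<Rightarrow> bool" where
  "rank_le I A r \<longleftrightarrow> (\<exists>u :: nat \<Rightarrow> 'i \<Rightarrow> complex. \<forall>x\<in>ell2 I. \<exists>c :: nat \<Rightarrow> complex.
     mat_app I A x = (\<lambda>i. \<Sum>m<r. c m * u m i))"

text \<open>
  \<open>s\<^sub>j(T) = inf {\<parallel>T - K\<parallel> : rank K \<le> j}\<close>, \<open>j \<ge> 0\<close>. This covers all bounded operators: the values do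
  not tend to \<open>0\<close> when \<open>T\<close> is not compact.
\<close>

definition singular_value :: "'i set \<Rightarrow> 'i cmatrix \<Rightarrow> nat \<Rightarrow> real" where
  "singular_value I A j =
     Inf {op_norm I (\<lambda>i k. A i k - K i k) | K. bounded_mat I K \<and> rank_le I K j}"

definition schatten :: "'i set \<Rightarrow> real \<Rightarrow> 'i cmatrix set" where
  "schatten I p = {A. bounded_mat I A \<and> summable (\<lambda>j. singular_value I A j powr p)}"

definition schatten_norm :: "'i set \<Rightarrow> real \<Rightarrow> 'i cmatrix \<Rightarrow> real" where
  "schatten_norm I p A = (\<Sum>j. singular_value I A j powr p) powr (1 / p)"

definition schur_prod :: "'i cmatrix \<Rightarrow> 'i cmatrix \<Rightarrow> 'i cmatrix" (infixl "\<star>" 70) where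
  "A \<star> B = (\<lambda>j k. A j k * B j k)"

text \<open>The norm is \<open>\<infinity>\<close> on matrices outside the class, and the supremum may be \<open>\<infinity>\<close>.\<close>

definition multiplier_norm :: "'i set \<Rightarrow> real \<Rightarrow> 'i cmatrix \<Rightarrow> ennreal" where
  "multiplier_norm I p A =
     (SUP B \<in> {B \<in> schatten I p. schatten_norm I p B \<le> 1}.
        if A \<star> B \<in> schatten I p then ennreal (schatten_norm I p (A \<star> B)) else \<infinity>)"

text \<open>The size \<open>n\<close> of the matrix \<open>\<chi>\<^sub>n\<close> is carried by its index set \<open>{1..n}\<close>.\<close>

definition chi :: "nat cmatrix" where
  "chi j k = (if j \<le> k then 1 else 0)"

definition Delta :: "nat \<Rightarrow> nat cmatrix" where
  "Delta n j k = (if j + k < n then 1 else 0)"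

end

theory Submission
  imports Defs
begin

text \<open>
  Reversing the columns turns \<open>\<Delta>\<^sub>n\<close> into \<open>\<chi>\<^sub>n\<close>, and passing between \<open>n \<times> n\<close> and infinite matrices
  by compression and by extension with zeros does not increase singular values; this gives the
  equality of the two norms.

  For the lower bound, the matrix with all entries \<open>1/n\<close> has norm at most \<open>1\<close>, while all \<open>n\<close> singular
  values of \<open>\<chi>\<^sub>n\<close> are at least \<open>1/2\<close>.

  For the upper bound fix \<open>q\<close> with \<open>p < q < 1\<close> and measure a matrix by the cost
  \<open>\<Sum>(\<parallel>u\<^sub>m\<parallel>\<parallel>v\<^sub>m\<parallel>)\<^sup>q\<close> of a decomposition \<open>\<Sum>u\<^sub>m \<otimes> v\<^sub>m\<close> into rank one matrices. A matrix \<open>B\<close> with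
  \<open>\<parallel>B\<parallel>\<^sub>p \<le> 1\<close> has a decomposition of bounded cost, built from its best approximations of rank
  less than \<open>2\<^sup>l\<close>. Triangular truncation multiplies the cost by at most a constant times
  \<open>n\<^bsup>1-q\<^esup>\<close>, and a matrix of cost \<open>A\<close> has singular values at most \<open>(6A/(j+1))\<^bsup>1/q\<^esup>\<close>. As \<open>p/q < 1\<close>,
  the \<open>p\<close>-th powers of these bounds for \<open>j < n\<close> and \<open>A\<close> of order \<open>n\<^bsup>1-q\<^esup>\<close> sum up to the order of
  \<open>n\<^bsup>1-p\<^esup>\<close>. The weak type estimates with an exponent \<open>q > p\<close> make the triangle inequality for the
  quasinorm and the singular value decomposition unnecessary.
\<close>

section \<open>Euclidean norms and bounds for the operator norm\<close>

abbreviation l2 :: "'i set \<Rightarrow> ('i \<Rightarrow> complex) \<Rightarrow> real" where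
  "l2 I x \<equiv> L2_set (\<lambda>i. cmod (x i)) I"

abbreviation app :: "'i set \<Rightarrow> 'i cmatrix \<Rightarrow> ('i \<Rightarrow> complex) \<Rightarrow> 'i \<Rightarrow> complex" where
  "app I A x i \<equiv> \<Sum>k\<in>I. A i k * x k"

text \<open>For finite \<open>I\<close> and \<open>0 \<le> t\<close> this expresses
  \<open>op_norm I A \<le> t\<close> without the supremum. \<open>x\<close> ranges over all
  functions, since values outside \<open>I\<close> do not enter.\<close>

definition op_bound :: "'i set \<Rightarrow> 'i cmatrix \<Rightarrow> real \<Rightarrow> bool" where
  "op_bound I A t \<longleftrightarrow> (\<forall>x. l2 I (app I A x) \<le> t * l2 I x)"

lemma ell2_norm_nonneg [simp]: "0 \<le> ell2_norm I x"
  by (simp add: ell2_norm_def infsum_nonneg)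

text \<open>Boundedness makes the set in the definition of \<open>op_norm\<close> bounded above, so
  the real supremum is a true upper bound. General vectors are reduced to the unit ball by
  normalisation, and the zero vector gives nonnegativity.\<close>

lemma
  assumes "bounded_mat J A"
  shows ell2_norm_mat_app_le: "x \<in> ell2 J \<Longrightarrow> ell2_norm J (mat_app J A x) \<le> op_norm J A * ell2_norm J x"
    and op_norm_nonneg: "0 \<le> op_norm J A"
proof -
  let ?S = "{ell2_norm J (mat_app J A x) | x. x \<in> ell2 J \<and> ell2_norm J x \<le> 1}"
  obtain C where C: "\<And>x. x \<in> ell2 J \<Longrightarrow> (\<forall>j\<in>J. (\<lambda>k. A j k * x k) summable_on J) \<and>
      mat_app J A x \<in> ell2 J \<and> ell2_norm J (mat_app J A x) \<le> C * ell2_norm J x"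
    using assms unfolding bounded_mat_def by blast
  have "ell2_norm J (mat_app J A x) \<le> \<bar>C\<bar>" if "x \<in> ell2 J" "ell2_norm J x \<le> 1" for x
  proof -
    have "C * ell2_norm J x \<le> \<bar>C\<bar> * 1"
      using that by (intro mult_mono) auto
    with C[OF that(1)] show ?thesis by simp
  qed
  then have bdd: "bdd_above ?S"
    by (auto intro!: bdd_aboveI)
  have 0: "(\<lambda>_. 0) \<in> ell2 J" "ell2_norm J (\<lambda>_. 0) = 0" "mat_app J A (\<lambda>_. 0) = (\<lambda>_. 0)"
    by (simp_all add: ell2_def ell2_norm_def mat_app_def fun_eq_iff)
  have "0 \<in> ?S" using 0 by force
  then show "0 \<le> op_norm J A"
    unfolding op_norm_def using bdd by (rule cSup_upper)
  assume x: "x \<in> ell2 J"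
  show "ell2_norm J (mat_app J A x) \<le> op_norm J A * ell2_norm J x"
  proof (cases "ell2_norm J x = 0")
    case True
    with C[OF x] show ?thesis by simp
  next
    case False
    then have pos: "0 < ell2_norm J x" by (simp add: less_le)
    define c where "c = complex_of_real (1 / ell2_norm J x)"
    have c: "cmod c = 1 / ell2_norm J x" using pos unfolding c_def by (simp only: norm_of_real) simp
    have scale: "ell2_norm J (\<lambda>j. c * y j) = cmod c * ell2_norm J y" for y
      by (simp add: ell2_norm_def norm_mult power_mult_distrib infsum_cmult_right' real_sqrt_mult)
    have cx: "(\<lambda>k. c * x k) \<in> ell2 J"
      using x by (auto simp: ell2_def norm_mult power_mult_distrib intro: summable_on_cmult_right)
    have "ell2_norm J (\<lambda>k. c * x k) = 1"
      using pos by (simp add: scale c)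
    moreover have "mat_app J A (\<lambda>k. c * x k) = (\<lambda>j. c * mat_app J A x j)"
      by (auto simp: mat_app_def fun_eq_iff mult.left_commute infsum_cmult_right')
    ultimately have "cmod c * ell2_norm J (mat_app J A x) \<in> ?S"
      using cx scale by (auto intro!: exI[of _ "\<lambda>k. c * x k"])
    then have "cmod c * ell2_norm J (mat_app J A x) \<le> op_norm J A"
      unfolding op_norm_def using bdd by (rule cSup_upper)
    with pos show ?thesis
      by (simp add: c divide_le_eq)
  qed
qed

subsection \<open>Finite index sets\<close>

lemma ell2_norm_finite: "finite I \<Longrightarrow> ell2_norm I x = l2 I x"
  by (simp add: ell2_norm_def L2_set_def)

lemma ell2_finite: "finite I \<Longrightarrow> x \<in> ell2 I \<longleftrightarrow> (\<forall>i. i \<notin> I \<longrightarrow> x i = 0)"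
  by (simp add: ell2_def)

lemma l2_cong: "(\<And>i. i \<in> I \<Longrightarrow> x i = y i) \<Longrightarrow> l2 I x = l2 I y"
  by (rule L2_set_cong) auto

lemma app_cong: "(\<And>k. k \<in> I \<Longrightarrow> A i k * x k = B i k * y k) \<Longrightarrow> app I A x i = app I B y i"
  by (rule sum.cong) auto

lemma l2_power2: "(l2 I x)\<^sup>2 = (\<Sum>i\<in>I. (cmod (x i))\<^sup>2)"
  by (simp add: L2_set_def sum_nonneg)

lemma l2_mult: "l2 I (\<lambda>i. c * x i) = cmod c * l2 I x"
  by (simp add: norm_mult L2_set_right_distrib)

lemma l2_add_le: "l2 I (\<lambda>i. x i + y i) \<le> l2 I x + l2 I y"
proof -
  have "l2 I (\<lambda>i. x i + y i) \<le> L2_set (\<lambda>i. cmod (x i) + cmod (y i)) I"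
    by (intro L2_set_mono norm_triangle_ineq) auto
  also have "\<dots> \<le> l2 I x + l2 I y"
    by (rule L2_set_triangle_ineq)
  finally show ?thesis .
qed

lemma cmod_sum_mult_le: "cmod (\<Sum>i\<in>I. x i * y i) \<le> l2 I x * l2 I y"
proof -
  have "cmod (\<Sum>i\<in>I. x i * y i) \<le> (\<Sum>i\<in>I. \<bar>cmod (x i)\<bar> * \<bar>cmod (y i)\<bar>)"
    using norm_sum[of "\<lambda>i. x i * y i" I] by (simp add: norm_mult)
  also have "\<dots> \<le> l2 I x * l2 I y"
    by (rule L2_set_mult_ineq)
  finally show ?thesis .
qed

lemma mat_app_finite: "finite I \<Longrightarrow> mat_app I A x = (\<lambda>i. if i \<in> I then app I A x i else 0)"
  by (simp add: mat_app_def cong: if_cong)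

lemma op_bound_exists:
  assumes "finite I"
  shows "op_bound I A (\<Sum>i\<in>I. \<Sum>k\<in>I. cmod (A i k))"
  unfolding op_bound_def
proof
  fix x
  have "l2 I (app I A x) \<le> (\<Sum>i\<in>I. \<bar>cmod (app I A x i)\<bar>)"
    by (rule L2_set_le_sum_abs)
  also have "\<dots> \<le> (\<Sum>i\<in>I. \<Sum>k\<in>I. cmod (A i k) * l2 I x)"
  proof (rule sum_mono)
    fix i assume "i \<in> I"
    have "\<bar>cmod (app I A x i)\<bar> \<le> (\<Sum>k\<in>I. cmod (A i k * x k))"
      by (simp add: norm_sum)
    also have "\<dots> \<le> (\<Sum>k\<in>I. cmod (A i k) * l2 I x)"
      unfolding norm_mult using assms
      by (intro sum_mono mult_left_mono member_le_L2_set) auto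
    finally show "\<bar>cmod (app I A x i)\<bar> \<le> (\<Sum>k\<in>I. cmod (A i k) * l2 I x)" .
  qed
  also have "\<dots> = (\<Sum>i\<in>I. \<Sum>k\<in>I. cmod (A i k)) * l2 I x"
    by (simp add: sum_distrib_right)
  finally show "l2 I (app I A x) \<le> (\<Sum>i\<in>I. \<Sum>k\<in>I. cmod (A i k)) * l2 I x" .
qed

lemma bounded_mat_finite [simp]:
  assumes "finite I"
  shows "bounded_mat I A"
  using op_bound_exists[OF assms, of A] assms
  unfolding bounded_mat_def op_bound_def
  by (auto simp: ell2_norm_finite mat_app_finite ell2_finite cong: L2_set_cong)

section \<open>Rank bounds over a finite index set\<close>

lemma rank_le_finite_iff:
  assumes "finite I"
  shows "rank_le I A r \<longleftrightarrow>
    (\<exists>u :: nat \<Rightarrow> _. \<forall>x. \<exists>c :: nat \<Rightarrow> _. \<forall>i\<in>I. app I A x i = (\<Sum>m<r. c m * u m i))"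
    (is "_ \<longleftrightarrow> (\<exists>u. ?P u)")
proof
  assume "rank_le I A r"
  then obtain u where u: "\<And>x. x \<in> ell2 I \<Longrightarrow>
      \<exists>c :: nat \<Rightarrow> _. mat_app I A x = (\<lambda>i. \<Sum>m<r. c m * u m i)"
    unfolding rank_le_def by blast
  have "?P u"
  proof
    fix x
    \<comment> \<open>Cutting \<open>x\<close> off outside \<open>I\<close> puts it into
      \<open>ell2 I\<close> and does not change the sums over \<open>I\<close>.\<close>
    have "(\<lambda>k. if k \<in> I then x k else 0) \<in> ell2 I"
      using assms by (simp add: ell2_finite)
    from u[OF this] obtain c where
      c: "mat_app I A (\<lambda>k. if k \<in> I then x k else 0) = (\<lambda>i. \<Sum>m<r. c m * u m i)" ..
    have "app I A x i = (\<Sum>m<r. c m * u m i)" if "i \<in> I" for i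
    proof -
      have "app I A x i = app I A (\<lambda>k. if k \<in> I then x k else 0) i"
        by (rule sum.cong) auto
      also have "\<dots> = (\<Sum>m<r. c m * u m i)"
        using fun_cong[OF c, of i] that assms by (simp add: mat_app_finite)
      finally show ?thesis .
    qed
    then show "\<exists>c :: nat \<Rightarrow> _. \<forall>i\<in>I. app I A x i = (\<Sum>m<r. c m * u m i)"
      by blast
  qed
  then show "\<exists>u. ?P u"
    by (intro exI[of _ u])
next
  assume "\<exists>u. ?P u"
  then obtain u where u: "?P u" ..
  show "rank_le I A r"
    unfolding rank_le_def
  proof (rule exI, rule ballI)
    fix x
    from u obtain c where "\<forall>i\<in>I. app I A x i = (\<Sum>m<r. c m * u m i)"
      by blast
    \<comment> \<open>\<open>mat_app\<close> vanishes outside \<open>I\<close>, so the spanning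
      vectors are cut off there as well.\<close>
    then show "\<exists>c. mat_app I A x = (\<lambda>i. \<Sum>m<r. c m * (if i \<in> I then u m i else 0))"
      using assms by (intro exI[of _ c]) (auto simp: mat_app_finite fun_eq_iff)
  qed
qed

lemma rank_le_zero:
  assumes "finite I" and "\<And>i k. i \<in> I \<Longrightarrow> k \<in> I \<Longrightarrow> A i k = 0"
  shows "rank_le I A 0"
  using assms by (simp add: rank_le_finite_iff)

lemma rank_le_add:
  assumes "finite I" "rank_le I A r" "rank_le I B s"
  shows "rank_le I (\<lambda>i k. A i k + B i k) (r + s)"
proof -
  obtain u where u: "\<And>x. \<exists>c :: nat \<Rightarrow> _. \<forall>i\<in>I. app I A x i = (\<Sum>m<r. c m * u m i)"
    using assms by (auto simp: rank_le_finite_iff)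
  obtain v where v: "\<And>x. \<exists>c :: nat \<Rightarrow> _. \<forall>i\<in>I. app I B x i = (\<Sum>m<s. c m * v m i)"
    using assms by (auto simp: rank_le_finite_iff)
  show ?thesis
    unfolding rank_le_finite_iff[OF assms(1)]
  proof (rule exI, rule allI)
    fix x
    obtain c where c: "\<forall>i\<in>I. app I A x i = (\<Sum>m<r. c m * u m i)" using u by blast
    obtain d where d: "\<forall>i\<in>I. app I B x i = (\<Sum>m<s. d m * v m i)" using v by blast
    \<comment> \<open>The vectors spanning the range of \<open>A\<close> are followed by those for
      \<open>B\<close>, shifted by \<open>r\<close>.\<close>
    show "\<exists>e :: nat \<Rightarrow> _. \<forall>i\<in>I. app I (\<lambda>i k. A i k + B i k) x i
        = (\<Sum>m<r + s. e m * (if m < r then u m i else v (m - r) i))"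
    proof (intro exI ballI)
      fix i assume i: "i \<in> I"
      have "(\<Sum>m<r + s. (if m < r then c m else d (m - r)) * (if m < r then u m i else v (m - r) i))
          = (\<Sum>m<r. c m * u m i) + (\<Sum>m<s. d m * v m i)"
        by (induction s) auto
      then show "app I (\<lambda>i k. A i k + B i k) x i
          = (\<Sum>m<r + s. (if m < r then c m else d (m - r)) * (if m < r then u m i else v (m - r) i))"
        using c d i by (simp add: distrib_right sum.distrib)
    qed
  qed
qed

lemma rank_le_uminus:
  assumes "finite I" "rank_le I A r"
  shows "rank_le I (\<lambda>i k. - A i k) r"
proof -
  obtain u where u: "\<And>x. \<exists>c :: nat \<Rightarrow> _. \<forall>i\<in>I. app I A x i = (\<Sum>m<r. c m * u m i)"
    using assms by (auto simp: rank_le_finite_iff)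
  show ?thesis
    unfolding rank_le_finite_iff[OF assms(1)]
  proof (rule exI, rule allI)
    fix x
    obtain c where c: "\<forall>i\<in>I. app I A x i = (\<Sum>m<r. c m * u m i)" using u by blast
    then show "\<exists>e :: nat \<Rightarrow> _. \<forall>i\<in>I. app I (\<lambda>i k. - A i k) x i = (\<Sum>m<r. e m * u m i)"
      by (intro exI[of _ "\<lambda>m. - c m"]) (auto simp: sum_negf)
  qed
qed

lemma rank_le_mono:
  assumes "finite I" "rank_le I A r" "r \<le> s"
  shows "rank_le I A s"
proof -
  obtain u where u: "\<And>x. \<exists>c :: nat \<Rightarrow> _. \<forall>i\<in>I. app I A x i = (\<Sum>m<r. c m * u m i)"
    using assms by (auto simp: rank_le_finite_iff)
  show ?thesis
    unfolding rank_le_finite_iff[OF assms(1)]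
  proof (rule exI, rule allI)
    fix x
    obtain c where c: "\<forall>i\<in>I. app I A x i = (\<Sum>m<r. c m * u m i)" using u by blast
    have "(\<Sum>m<s. (if m < r then c m else 0) * u m i) = (\<Sum>m<r. c m * u m i)" for i
      using assms(3) by (intro sum.mono_neutral_cong_right) auto
    with c show "\<exists>e :: nat \<Rightarrow> _. \<forall>i\<in>I. app I A x i = (\<Sum>m<s. e m * u m i)"
      by (intro exI[of _ "\<lambda>m. if m < r then c m else 0"]) auto
  qed
qed

lemma rank_le_rank_one:
  assumes "finite I"
  shows "rank_le I (\<lambda>i k. u i * v k) 1"
  unfolding rank_le_finite_iff[OF assms]
proof (rule exI, rule allI)
  fix x
  show "\<exists>c :: nat \<Rightarrow> _. \<forall>i\<in>I. app I (\<lambda>i k. u i * v k) x i = (\<Sum>m<1. c m * u i)"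
    by (intro exI[of _ "\<lambda>_. \<Sum>k\<in>I. v k * x k"])
       (auto simp: sum_distrib_left sum_distrib_right mult_ac)
qed

lemma rank_le_sum:
  assumes "finite I" "finite F"
  shows "rank_le I (\<lambda>i k. \<Sum>m\<in>F. u m i * v m k) (card F)"
  using assms(2)
proof induction
  case empty
  then show ?case using assms(1) by (simp add: rank_le_zero)
next
  case (insert l F)
  with rank_le_add[OF assms(1) rank_le_rank_one[OF assms(1), of "u l" "v l"] insert.IH]
  show ?case by simp
qed

text \<open>The matrix is the sum over \<open>m\<close> in \<open>I\<close> of the
  \<open>m\<close>-th unit column times the \<open>m\<close>-th row of \<open>A\<close>.\<close>

lemma rank_le_card:
  assumes "finite I"
  shows "rank_le I A (card I)"
  using rank_le_sum[OF assms assms, of "\<lambda>m i. of_bool (i = m)" A] assms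
  by (simp add: rank_le_finite_iff of_bool_def if_distrib[of "\<lambda>x. x * _"] cong: if_cong)

section \<open>Operator norm and singular values over a finite index set\<close>

lemma op_norm_le_iff:
  assumes "finite I" "0 \<le> t"
  shows "op_norm I A \<le> t \<longleftrightarrow> op_bound I A t"
proof
  have norm_app: "ell2_norm I (mat_app I A x) = l2 I (app I A x)" for x
    using assms(1) by (auto simp: ell2_norm_finite mat_app_finite intro: L2_set_cong)
  show "op_bound I A t" if t: "op_norm I A \<le> t"
    unfolding op_bound_def
  proof
    fix x :: "'a \<Rightarrow> complex"
    \<comment> \<open>The cut-off vector belongs to \<open>ell2 I\<close> and has the same norm and
      the same image on \<open>I\<close> as \<open>x\<close>.\<close>
    define z where "z = (\<lambda>k. if k \<in> I then x k else 0)"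
    have z: "z \<in> ell2 I" "l2 I z = l2 I x"
      using assms(1) by (auto simp: ell2_finite z_def intro: L2_set_cong)
    have "l2 I (app I A x) = l2 I (app I A z)"
      by (intro l2_cong app_cong) (simp add: z_def)
    also have "\<dots> \<le> op_norm I A * l2 I x"
      using ell2_norm_mat_app_le[OF bounded_mat_finite[OF assms(1)] z(1), of A] assms(1)
      by (simp only: norm_app ell2_norm_finite z(2))
    also have "\<dots> \<le> t * l2 I x"
      using t by (intro mult_right_mono) auto
    finally show "l2 I (app I A x) \<le> t * l2 I x" .
  qed
  show "op_norm I A \<le> t" if t: "op_bound I A t"
    unfolding op_norm_def
  proof (rule cSup_least)
    have "(\<lambda>_. 0) \<in> ell2 I" "ell2_norm I (\<lambda>_. 0) \<le> 1"
      by (simp_all add: ell2_def ell2_norm_def)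
    then show "{ell2_norm I (mat_app I A x) |x. x \<in> ell2 I \<and> ell2_norm I x \<le> 1} \<noteq> {}"
      by blast
  next
    fix y assume "y \<in> {ell2_norm I (mat_app I A x) |x. x \<in> ell2 I \<and> ell2_norm I x \<le> 1}"
    then obtain x where x: "y = l2 I (app I A x)" "ell2_norm I x \<le> 1"
      unfolding norm_app by blast
    have "y \<le> t * l2 I x"
      using t unfolding x(1) op_bound_def by blast
    also have "\<dots> \<le> t * 1"
      using assms x(2) by (intro mult_left_mono) (simp_all add: ell2_norm_finite)
    finally show "y \<le> t" by simp
  qed
qed

lemma op_norm_nonneg_finite: "finite I \<Longrightarrow> 0 \<le> op_norm I A"
  by (intro op_norm_nonneg bounded_mat_finite)

lemma op_bound_op_norm:
  assumes "finite I"
  shows "op_bound I A (op_norm I A)"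
  using op_norm_le_iff[OF assms op_norm_nonneg_finite[OF assms]] by blast

lemma singular_value_le:
  assumes "finite I" "rank_le I K j" "op_bound I (\<lambda>i k. A i k - K i k) t" "0 \<le> t"
  shows "singular_value I A j \<le> t"
proof -
  have "singular_value I A j \<le> op_norm I (\<lambda>i k. A i k - K i k)"
    unfolding singular_value_def
    using assms by (intro cInf_lower bdd_belowI[of _ 0]) (auto intro: op_norm_nonneg_finite)
  also have "\<dots> \<le> t"
    using assms by (simp add: op_norm_le_iff)
  finally show ?thesis .
qed

text \<open>It suffices to test bounds \<open>s\<close> that are operator norms, which is why
  \<open>0 \<le> s\<close> may be assumed. For \<open>t = 0\<close> this assumption alone yields
  nonnegativity of singular values.\<close>

lemma singular_value_ge:
  assumes "finite I"
    and "\<And>K s. rank_le I K j \<Longrightarrow> op_bound I (\<lambda>i k. A i k - K i k) s \<Longrightarrow> 0 \<le> s \<Longrightarrow> t \<le> s"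
  shows "t \<le> singular_value I A j"
  unfolding singular_value_def
proof (rule cInf_greatest)
  have "rank_le I (\<lambda>_ _. 0) j"
    using rank_le_mono[OF assms(1) rank_le_zero[OF assms(1)]] by simp
  then show "{op_norm I (\<lambda>i k. A i k - K i k) | K. bounded_mat I K \<and> rank_le I K j} \<noteq> {}"
    using assms(1) by auto
qed (use assms in \<open>auto intro: op_bound_op_norm op_norm_nonneg_finite\<close>)

lemma singular_value_nonneg: "finite I \<Longrightarrow> 0 \<le> singular_value I A j"
  by (rule singular_value_ge)

text \<open>The strict inequality avoids the question whether the infimum is attained. It is the
  origin of the factor \<open>2\<close> in the errors used in
  \<open>atomic_of_singular_values_le\<close>.\<close>

lemma singular_value_approx:
  assumes "finite I" "singular_value I A j < t"
  obtains K where "rank_le I K j" "op_bound I (\<lambda>i k. A i k - K i k) t"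
proof -
  have "\<exists>K s. rank_le I K j \<and> op_bound I (\<lambda>i k. A i k - K i k) s \<and> s < t"
  proof (rule ccontr)
    assume "\<not> ?thesis"
    then have "t \<le> singular_value I A j"
      by (intro singular_value_ge[OF assms(1)]) (auto simp: not_less)
    with assms show False by simp
  qed
  then obtain K s where K: "rank_le I K j" "op_bound I (\<lambda>i k. A i k - K i k) s" "s < t"
    by blast
  have "op_bound I (\<lambda>i k. A i k - K i k) t"
    using K(2,3) unfolding op_bound_def
    by (meson L2_set_nonneg less_imp_le mult_right_mono order_trans)
  with K(1) show thesis by (rule that)
qed

lemma singular_value_antimono:
  assumes "finite I" "i \<le> j"
  shows "singular_value I A j \<le> singular_value I A i"
  using assms by (intro singular_value_ge) (auto intro!: singular_value_le rank_le_mono[of I _ i j])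

lemma singular_value_eq_0:
  assumes "finite I" "rank_le I A r" "r \<le> j"
  shows "singular_value I A j = 0"
proof (rule antisym)
  show "singular_value I A j \<le> 0"
    using assms rank_le_mono[OF assms]
    by (intro singular_value_le) (auto simp: op_bound_def L2_set_def)
qed (use assms singular_value_nonneg in auto)

lemma singular_value_cong:
  assumes "finite I" "\<And>i k. i \<in> I \<Longrightarrow> k \<in> I \<Longrightarrow> A i k = B i k"
  shows "singular_value I A = singular_value I B"
proof -
  have *: "singular_value I A j \<le> singular_value I B j"
    if eq: "\<And>i k. i \<in> I \<Longrightarrow> k \<in> I \<Longrightarrow> A i k = B i k" for A B j
  proof (rule singular_value_ge[OF assms(1)])
    fix K s
    assume K: "rank_le I K j" "op_bound I (\<lambda>i k. B i k - K i k) s" "0 \<le> s"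
    have "l2 I (app I (\<lambda>i k. A i k - K i k) x) = l2 I (app I (\<lambda>i k. B i k - K i k) x)" for x
      by (intro l2_cong app_cong) (simp add: eq)
    with K show "singular_value I A j \<le> s"
      by (intro singular_value_le[OF assms(1), of K]) (auto simp: op_bound_def)
  qed
  show ?thesis
    by (intro ext antisym *) (simp_all add: assms(2))
qed

text \<open>Singular values with index at least \<open>card I\<close> vanish, so the series is a
  finite sum and convergence is automatic.\<close>

lemma schatten_finite:
  assumes "finite I"
  shows "A \<in> schatten I p"
    and "schatten_norm I p A = (\<Sum>j<card I. singular_value I A j powr p) powr (1 / p)"
proof -
  have 0: "singular_value I A j powr p = 0" if "j \<notin> {..<card I}" for j
    using that singular_value_eq_0[OF assms rank_le_card[OF assms], of j A] by simp
  have "summable (\<lambda>j. singular_value I A j powr p)"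
    by (rule summable_finite[of "{..<card I}"]) (simp, rule 0)
  then show "A \<in> schatten I p"
    using assms by (simp add: schatten_def)
  show "schatten_norm I p A = (\<Sum>j<card I. singular_value I A j powr p) powr (1 / p)"
    unfolding schatten_norm_def by (subst suminf_finite[of "{..<card I}"]) (simp, rule 0, simp_all)
qed

subsection \<open>Change of the index set\<close>

lemma ell2_norm_power2: "(ell2_norm I x)\<^sup>2 = (\<Sum>\<^sub>\<infinity>i\<in>I. (cmod (x i))\<^sup>2)"
  by (simp add: ell2_norm_def infsum_nonneg)

lemma l2_le_ell2_norm:
  assumes "x \<in> ell2 J" "finite I" "inj_on \<phi> I" "\<phi> ` I \<subseteq> J"
  shows "l2 I (\<lambda>i. x (\<phi> i)) \<le> ell2_norm J x"
proof (rule power2_le_imp_le)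
  have "(l2 I (\<lambda>i. x (\<phi> i)))\<^sup>2 = (\<Sum>j\<in>\<phi> ` I. (cmod (x j))\<^sup>2)"
    using assms(3) by (simp add: l2_power2 sum.reindex)
  also have "\<dots> \<le> (\<Sum>\<^sub>\<infinity>j\<in>J. (cmod (x j))\<^sup>2)"
    using assms by (intro finite_sum_le_infsum) (auto simp: ell2_def)
  finally show "(l2 I (\<lambda>i. x (\<phi> i)))\<^sup>2 \<le> (ell2_norm J x)\<^sup>2"
    by (simp add: ell2_norm_power2)
qed simp

lemma ell2_supported:
  assumes "finite I" "inj_on \<phi> I" "\<phi> ` I \<subseteq> J" "\<And>j. j \<notin> \<phi> ` I \<Longrightarrow> x j = 0"
  shows "x \<in> ell2 J" and "ell2_norm J x = l2 I (\<lambda>i. x (\<phi> i))"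
proof -
  have "(\<lambda>j. (cmod (x j))\<^sup>2) summable_on J \<longleftrightarrow> (\<lambda>j. (cmod (x j))\<^sup>2) summable_on \<phi> ` I"
    by (rule summable_on_cong_neutral) (use assms in auto)
  moreover have "x j = 0" if "j \<notin> J" for j
    using that assms(3) by (intro assms(4)) auto
  ultimately show "x \<in> ell2 J"
    using assms(1) by (simp add: ell2_def)
  have "(\<Sum>\<^sub>\<infinity>j\<in>J. (cmod (x j))\<^sup>2) = (\<Sum>\<^sub>\<infinity>j\<in>\<phi> ` I. (cmod (x j))\<^sup>2)"
    by (rule infsum_cong_neutral) (use assms in auto)
  also have "\<dots> = (\<Sum>i\<in>I. (cmod (x (\<phi> i)))\<^sup>2)"
    using assms by (simp add: sum.reindex)
  finally show "ell2_norm J x = l2 I (\<lambda>i. x (\<phi> i))"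
    by (simp add: ell2_norm_def L2_set_def)
qed

text \<open>The inequality \<open>(a + b)^2 \<le> 2 * a^2 + 2 * b^2\<close> stands in for the
  triangle inequality. The loss in the constant is harmless, as only boundedness of differences is
  derived from it.\<close>

lemma ell2_diff:
  assumes "x \<in> ell2 J" "y \<in> ell2 J"
  shows "(\<lambda>i. x i - y i) \<in> ell2 J"
    and "(ell2_norm J (\<lambda>i. x i - y i))\<^sup>2 \<le> 2 * (ell2_norm J x)\<^sup>2 + 2 * (ell2_norm J y)\<^sup>2"
proof -
  have le: "(cmod (x i - y i))\<^sup>2 \<le> 2 * (cmod (x i))\<^sup>2 + 2 * (cmod (y i))\<^sup>2" for i
  proof -
    have "(cmod (x i - y i))\<^sup>2 \<le> (cmod (x i) + cmod (y i))\<^sup>2"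
      by (intro power_mono norm_triangle_ineq4) simp
    also have "\<dots> \<le> 2 * (cmod (x i))\<^sup>2 + 2 * (cmod (y i))\<^sup>2"
      using sum_squares_bound[of "cmod (x i)" "cmod (y i)"] by (simp add: power2_sum)
    finally show ?thesis .
  qed
  have sx: "(\<lambda>i. 2 * (cmod (x i))\<^sup>2) summable_on J" and sy: "(\<lambda>i. 2 * (cmod (y i))\<^sup>2) summable_on J"
    using assms by (auto simp: ell2_def intro: summable_on_cmult_right)
  have s: "(\<lambda>i. (cmod (x i - y i))\<^sup>2) summable_on J"
    by (rule summable_on_comparison_test[OF summable_on_add[OF sx sy]]) (use le in auto)
  then show "(\<lambda>i. x i - y i) \<in> ell2 J"
    using assms by (simp add: ell2_def)
  have "(\<Sum>\<^sub>\<infinity>i\<in>J. (cmod (x i - y i))\<^sup>2)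
      \<le> (\<Sum>\<^sub>\<infinity>i\<in>J. 2 * (cmod (x i))\<^sup>2 + 2 * (cmod (y i))\<^sup>2)"
    by (rule infsum_mono[OF s summable_on_add[OF sx sy]]) (use le in auto)
  also have "\<dots> = 2 * (\<Sum>\<^sub>\<infinity>i\<in>J. (cmod (x i))\<^sup>2) + 2 * (\<Sum>\<^sub>\<infinity>i\<in>J. (cmod (y i))\<^sup>2)"
    using sx sy by (simp add: infsum_add infsum_cmult_right')
  finally show "(ell2_norm J (\<lambda>i. x i - y i))\<^sup>2 \<le> 2 * (ell2_norm J x)\<^sup>2 + 2 * (ell2_norm J y)\<^sup>2"
    by (simp add: ell2_norm_power2)
qed

lemma bounded_mat_diff:
  assumes "bounded_mat J A" "bounded_mat J B"
  shows "bounded_mat J (\<lambda>i k. A i k - B i k)"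
proof -
  obtain a where a: "\<And>x. x \<in> ell2 J \<Longrightarrow> (\<forall>j\<in>J. (\<lambda>k. A j k * x k) summable_on J) \<and>
      mat_app J A x \<in> ell2 J \<and> ell2_norm J (mat_app J A x) \<le> a * ell2_norm J x"
    using assms(1) unfolding bounded_mat_def by blast
  obtain b where b: "\<And>x. x \<in> ell2 J \<Longrightarrow> (\<forall>j\<in>J. (\<lambda>k. B j k * x k) summable_on J) \<and>
      mat_app J B x \<in> ell2 J \<and> ell2_norm J (mat_app J B x) \<le> b * ell2_norm J x"
    using assms(2) unfolding bounded_mat_def by blast
  show ?thesis
    unfolding bounded_mat_def
  proof (intro exI[of _ "sqrt (2 * a\<^sup>2 + 2 * b\<^sup>2)"] ballI conjI)
    fix x assume x: "x \<in> ell2 J"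
    show "(\<lambda>k. (A j k - B j k) * x k) summable_on J" if "j \<in> J" for j
      using summable_on_add[of "\<lambda>k. A j k * x k" J "\<lambda>k. - (B j k * x k)"] a[OF x] b[OF x] that
      by (simp add: left_diff_distrib summable_on_uminus)
    have eq: "mat_app J (\<lambda>i k. A i k - B i k) x = (\<lambda>j. mat_app J A x j - mat_app J B x j)"
    proof
      fix j
      show "mat_app J (\<lambda>i k. A i k - B i k) x j = mat_app J A x j - mat_app J B x j"
        using infsum_add[of "\<lambda>k. A j k * x k" J "\<lambda>k. - (B j k * x k)"] a[OF x] b[OF x]
        by (simp add: mat_app_def left_diff_distrib summable_on_uminus infsum_uminus)
    qed
    show "mat_app J (\<lambda>i k. A i k - B i k) x \<in> ell2 J"
      unfolding eq using a[OF x] b[OF x] by (intro ell2_diff) auto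
    show "ell2_norm J (mat_app J (\<lambda>i k. A i k - B i k) x) \<le> sqrt (2 * a\<^sup>2 + 2 * b\<^sup>2) * ell2_norm J x"
    proof (rule power2_le_imp_le)
      have "(ell2_norm J (mat_app J (\<lambda>i k. A i k - B i k) x))\<^sup>2
          \<le> 2 * (ell2_norm J (mat_app J A x))\<^sup>2 + 2 * (ell2_norm J (mat_app J B x))\<^sup>2"
        unfolding eq using a[OF x] b[OF x] by (intro ell2_diff) auto
      also have "\<dots> \<le> 2 * (a * ell2_norm J x)\<^sup>2 + 2 * (b * ell2_norm J x)\<^sup>2"
        using a[OF x] b[OF x] by (intro add_mono mult_left_mono power_mono) auto
      also have "\<dots> = (sqrt (2 * a\<^sup>2 + 2 * b\<^sup>2) * ell2_norm J x)\<^sup>2"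
        by (simp add: power_mult_distrib algebra_simps)
      finally show "(ell2_norm J (mat_app J (\<lambda>i k. A i k - B i k) x))\<^sup>2
          \<le> (sqrt (2 * a\<^sup>2 + 2 * b\<^sup>2) * ell2_norm J x)\<^sup>2" .
    qed simp
  qed
qed

text \<open>The compressed matrix is \<open>B\<close> preceded by the isometric extension by zeros
  along \<open>\<psi>\<close> and followed by the restriction along \<open>\<phi>\<close>, a
  contraction. Compressing an approximant of \<open>B\<close> in the same way keeps the rank bound
  and does not increase the error. Rows and columns have separate maps so that the columns alone can
  be reversed.\<close>

lemma singular_value_compress_le:
  assumes I: "finite I" "inj_on \<phi> I" "\<phi> ` I \<subseteq> J" "inj_on \<psi> I" "\<psi> ` I \<subseteq> J"
    and B: "bounded_mat J B"
  shows "singular_value I (\<lambda>i k. B (\<phi> i) (\<psi> k)) j \<le> singular_value J B j"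
  unfolding singular_value_def[of J]
proof (rule cInf_greatest)
  have app0: "mat_app J (\<lambda>_ _. 0) x = (\<lambda>_. 0)" for x
    by (simp add: mat_app_def fun_eq_iff)
  have "bounded_mat J (\<lambda>_ _. 0)"
    unfolding bounded_mat_def app0 by (intro exI[of _ 0]) (simp add: ell2_def ell2_norm_def)
  moreover have "rank_le J (\<lambda>_ _. 0) j"
    unfolding rank_le_def app0 by (intro exI[of _ "\<lambda>_ _. 0"]) (simp add: fun_eq_iff)
  ultimately show "{op_norm J (\<lambda>i k. B i k - K i k) |K. bounded_mat J K \<and> rank_le J K j} \<noteq> {}"
    by blast
next
  fix s assume "s \<in> {op_norm J (\<lambda>i k. B i k - K i k) |K. bounded_mat J K \<and> rank_le J K j}"
  then obtain K where s: "s = op_norm J (\<lambda>i k. B i k - K i k)"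
    and K: "bounded_mat J K" "rank_le J K j"
    by blast
  note BK = bounded_mat_diff[OF B K(1)]
  define ext :: "('a \<Rightarrow> complex) \<Rightarrow> _"
    where "ext x = (\<lambda>b. if b \<in> \<psi> ` I then x (inv_into I \<psi> b) else 0)" for x
  have ext_\<psi>: "ext x (\<psi> i) = x i" if "i \<in> I" for x i
    using that I(4) by (simp add: ext_def)
  have ext0: "ext x b = 0" if "b \<notin> \<psi> ` I" for x b
    using that by (simp add: ext_def)
  have ext: "ext x \<in> ell2 J" "ell2_norm J (ext x) = l2 I x" for x
  proof -
    show "ext x \<in> ell2 J"
      by (rule ell2_supported(1)[OF I(1,4,5)]) (simp add: ext0)
    show "ell2_norm J (ext x) = l2 I x"
      by (subst ell2_supported(2)[OF I(1,4,5)]) (auto simp: ext0 ext_\<psi> intro!: L2_set_cong)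
  qed
  have app: "mat_app J A (ext x) (\<phi> i) = app I (\<lambda>i k. A (\<phi> i) (\<psi> k)) x i" if "i \<in> I" for A x i
  proof -
    have "mat_app J A (ext x) (\<phi> i) = (\<Sum>\<^sub>\<infinity>b\<in>J. A (\<phi> i) b * ext x b)"
      using that I(3) by (auto simp: mat_app_def)
    also have "\<dots> = (\<Sum>\<^sub>\<infinity>b\<in>\<psi> ` I. A (\<phi> i) b * ext x b)"
      by (rule infsum_cong_neutral) (use I(5) in \<open>auto simp: ext0\<close>)
    also have "\<dots> = app I (\<lambda>i k. A (\<phi> i) (\<psi> k)) x i"
      using I(1,4) by (simp add: sum.reindex ext_\<psi>)
    finally show ?thesis .
  qed
  show "singular_value I (\<lambda>i k. B (\<phi> i) (\<psi> k)) j \<le> s"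
  proof (rule singular_value_le[OF I(1)])
    obtain u where u: "\<And>x. x \<in> ell2 J \<Longrightarrow>
        \<exists>c :: nat \<Rightarrow> complex. mat_app J K x = (\<lambda>i. \<Sum>m<j. c m * u m i)"
      using K(2) unfolding rank_le_def by blast
    show "rank_le I (\<lambda>i k. K (\<phi> i) (\<psi> k)) j"
      unfolding rank_le_finite_iff[OF I(1)]
    proof (rule exI, rule allI)
      fix x
      obtain c where "mat_app J K (ext x) = (\<lambda>i. \<Sum>m<j. c m * u m i)"
        using u[OF ext(1)] by blast
      then show "\<exists>c. \<forall>i\<in>I. app I (\<lambda>i k. K (\<phi> i) (\<psi> k)) x i = (\<Sum>m<j. c m * u m (\<phi> i))"
        by (intro exI[of _ c]) (simp flip: app)
    qed
    show "0 \<le> s"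
      unfolding s by (rule op_norm_nonneg[OF BK])
    show "op_bound I (\<lambda>i k. B (\<phi> i) (\<psi> k) - K (\<phi> i) (\<psi> k)) s"
      unfolding op_bound_def
    proof
      fix x
      let ?y = "mat_app J (\<lambda>i k. B i k - K i k) (ext x)"
      have "l2 I (app I (\<lambda>i k. B (\<phi> i) (\<psi> k) - K (\<phi> i) (\<psi> k)) x) = l2 I (\<lambda>i. ?y (\<phi> i))"
        by (rule l2_cong) (simp add: app)
      also have "\<dots> \<le> ell2_norm J ?y"
        using BK ext(1) by (intro l2_le_ell2_norm I) (auto simp: bounded_mat_def)
      also have "\<dots> \<le> s * ell2_norm J (ext x)"
        unfolding s by (rule ell2_norm_mat_app_le[OF BK ext(1)])
      finally show "l2 I (app I (\<lambda>i k. B (\<phi> i) (\<psi> k) - K (\<phi> i) (\<psi> k)) x) \<le> s * l2 I x"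
        by (simp add: ext(2))
    qed
  qed
qed

lemma
  assumes I: "finite I" "inj_on \<phi> I" "\<phi> ` I \<subseteq> J" "inj_on \<psi> I" "\<psi> ` I \<subseteq> J"
    and A: "\<And>a b. \<not> (a \<in> \<phi> ` I \<and> b \<in> \<psi> ` I) \<Longrightarrow> A a b = 0"
  shows bounded_mat_supported: "bounded_mat J A"
    and mat_app_supported: "x \<in> ell2 J \<Longrightarrow> mat_app J A x a =
      (if a \<in> \<phi> ` I then app I (\<lambda>i k. A (\<phi> i) (\<psi> k)) (\<lambda>k. x (\<psi> k)) (inv_into I \<phi> a) else 0)"
    and op_norm_supported_le: "op_bound I (\<lambda>i k. A (\<phi> i) (\<psi> k)) t \<Longrightarrow> 0 \<le> t \<Longrightarrow> op_norm J A \<le> t"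
proof -
  have app: "mat_app J A x a =
      (if a \<in> \<phi> ` I then app I (\<lambda>i k. A (\<phi> i) (\<psi> k)) (\<lambda>k. x (\<psi> k)) (inv_into I \<phi> a) else 0)" for x a
  proof -
    have "(\<Sum>\<^sub>\<infinity>b\<in>J. A a b * x b) = (\<Sum>\<^sub>\<infinity>b\<in>\<psi> ` I. A a b * x b)"
      by (rule infsum_cong_neutral) (use I(5) in \<open>auto simp: A\<close>)
    also have "\<dots> = (\<Sum>k\<in>I. A a (\<psi> k) * x (\<psi> k))"
      using I(1,4) by (simp add: sum.reindex)
    finally show ?thesis
      using I(2,3) by (auto simp: mat_app_def A)
  qed
  then show "mat_app J A x a =
      (if a \<in> \<phi> ` I then app I (\<lambda>i k. A (\<phi> i) (\<psi> k)) (\<lambda>k. x (\<psi> k)) (inv_into I \<phi> a) else 0)"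
    .
  have mem: "mat_app J A x \<in> ell2 J" for x
    by (rule ell2_supported[OF I(1-3)]) (simp add: app)
  have norm: "ell2_norm J (mat_app J A x) = l2 I (app I (\<lambda>i k. A (\<phi> i) (\<psi> k)) (\<lambda>k. x (\<psi> k)))" for x
    by (subst ell2_supported(2)[OF I(1-3)]) (use I(2) in \<open>auto simp: app intro!: L2_set_cong\<close>)
  have le: "ell2_norm J (mat_app J A x) \<le> t * ell2_norm J x"
    if "op_bound I (\<lambda>i k. A (\<phi> i) (\<psi> k)) t" "0 \<le> t" "x \<in> ell2 J" for t x
  proof -
    have "ell2_norm J (mat_app J A x) \<le> t * l2 I (\<lambda>k. x (\<psi> k))"
      using that(1) by (simp only: norm op_bound_def)
    also have "\<dots> \<le> t * ell2_norm J x"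
      using that by (intro mult_left_mono l2_le_ell2_norm I) auto
    finally show ?thesis .
  qed
  have "(\<lambda>k. A j k * x k) summable_on J" for j x
  proof -
    have "(\<lambda>k. A j k * x k) summable_on J \<longleftrightarrow> (\<lambda>k. A j k * x k) summable_on \<psi> ` I"
      by (rule summable_on_cong_neutral) (use I(5) in \<open>auto simp: A\<close>)
    with I(1) show ?thesis by simp
  qed
  with mem le[OF op_bound_exists[OF I(1)]] show "bounded_mat J A"
    unfolding bounded_mat_def by (blast intro: sum_nonneg norm_ge_zero)
  assume t: "op_bound I (\<lambda>i k. A (\<phi> i) (\<psi> k)) t" "0 \<le> t"
  show "op_norm J A \<le> t"
    unfolding op_norm_def
  proof (rule cSup_least)
    have "(\<lambda>_. 0) \<in> ell2 J" "ell2_norm J (\<lambda>_. 0) \<le> 1"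
      by (simp_all add: ell2_def ell2_norm_def)
    then show "{ell2_norm J (mat_app J A x) |x. x \<in> ell2 J \<and> ell2_norm J x \<le> 1} \<noteq> {}"
      by blast
  next
    fix y assume "y \<in> {ell2_norm J (mat_app J A x) |x. x \<in> ell2 J \<and> ell2_norm J x \<le> 1}"
    then obtain x where x: "y = ell2_norm J (mat_app J A x)" "x \<in> ell2 J" "ell2_norm J x \<le> 1"
      by blast
    have "y \<le> t * ell2_norm J x"
      unfolding x(1) by (rule le[OF t x(2)])
    also have "\<dots> \<le> t * 1"
      using t x by (intro mult_left_mono) auto
    finally show "y \<le> t" by simp
  qed
qed

text \<open>One inequality is compression. For the other, an approximant on \<open>I\<close> is
  extended by zeros to \<open>J\<close>, which preserves the rank bound and the error bound.\<close>

lemma singular_value_supported: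
  assumes I: "finite I" "inj_on \<phi> I" "\<phi> ` I \<subseteq> J" "inj_on \<psi> I" "\<psi> ` I \<subseteq> J"
    and A: "\<And>a b. \<not> (a \<in> \<phi> ` I \<and> b \<in> \<psi> ` I) \<Longrightarrow> A a b = 0"
  shows "singular_value J A = singular_value I (\<lambda>i k. A (\<phi> i) (\<psi> k))"
proof (rule ext, rule antisym)
  fix j
  have bA: "bounded_mat J A"
    using I A by (rule bounded_mat_supported)
  show "singular_value I (\<lambda>i k. A (\<phi> i) (\<psi> k)) j \<le> singular_value J A j"
    by (rule singular_value_compress_le[OF I bA])
  show "singular_value J A j \<le> singular_value I (\<lambda>i k. A (\<phi> i) (\<psi> k)) j"
  proof (rule singular_value_ge[OF I(1)])
    fix K s
    assume K: "rank_le I K j" "op_bound I (\<lambda>i k. A (\<phi> i) (\<psi> k) - K i k) s" "0 \<le> s"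
    define K' where "K' = (\<lambda>a b. if a \<in> \<phi> ` I \<and> b \<in> \<psi> ` I
      then K (inv_into I \<phi> a) (inv_into I \<psi> b) else 0)"
    have K'0: "K' a b = 0" if "\<not> (a \<in> \<phi> ` I \<and> b \<in> \<psi> ` I)" for a b
      using that unfolding K'_def by auto
    have K'_app: "K' (\<phi> i) (\<psi> k) = K i k" if "i \<in> I" "k \<in> I" for i k
      using that I(2,4) by (simp add: K'_def)
    have bK': "bounded_mat J K'"
      using I K'0 by (rule bounded_mat_supported)
    have rank: "rank_le J K' j"
    proof -
      obtain u where u: "\<And>x. \<exists>c :: nat \<Rightarrow> _. \<forall>i\<in>I. app I K x i = (\<Sum>m<j. c m * u m i)"
        using K(1) I(1) by (auto simp: rank_le_finite_iff)
      show ?thesis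
        unfolding rank_le_def
      proof (rule exI, rule ballI)
        fix x assume x: "x \<in> ell2 J"
        obtain c where c: "\<forall>i\<in>I. app I K (\<lambda>k. x (\<psi> k)) i = (\<Sum>m<j. c m * u m i)"
          using u[of "\<lambda>k. x (\<psi> k)"] by blast
        have "mat_app J K' x a
          = (\<Sum>m<j. c m * (if a \<in> \<phi> ` I then u m (inv_into I \<phi> a) else 0))" for a
        proof (cases "a \<in> \<phi> ` I")
          case True
          then have a: "inv_into I \<phi> a \<in> I" by (rule inv_into_into)
          have "mat_app J K' x a = app I (\<lambda>i k. K' (\<phi> i) (\<psi> k)) (\<lambda>k. x (\<psi> k)) (inv_into I \<phi> a)"
            using True mat_app_supported[OF I K'0 x] by simp
          also have "\<dots> = app I K (\<lambda>k. x (\<psi> k)) (inv_into I \<phi> a)"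
            by (intro app_cong) (simp add: K'_app a)
          finally show ?thesis using c a True by simp
        next
          case False
          then show ?thesis using mat_app_supported[OF I K'0 x] by simp
        qed
        then show "\<exists>c. mat_app J K' x
          = (\<lambda>a. \<Sum>m<j. c m * (if a \<in> \<phi> ` I then u m (inv_into I \<phi> a) else 0))"
          by blast
      qed
    qed
    have "singular_value J A j \<le> op_norm J (\<lambda>a b. A a b - K' a b)"
      unfolding singular_value_def using bK' rank bA
      by (intro cInf_lower bdd_belowI[of _ 0]) (auto intro: op_norm_nonneg bounded_mat_diff)
    also have "\<dots> \<le> s"
    proof (rule op_norm_supported_le[OF I _ _ K(3)])
      show "A a b - K' a b = 0" if "\<not> (a \<in> \<phi> ` I \<and> b \<in> \<psi> ` I)" for a b
        using A[OF that] K'0[OF that] by simp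
      have "l2 I (app I (\<lambda>i k. A (\<phi> i) (\<psi> k) - K' (\<phi> i) (\<psi> k)) x)
          = l2 I (app I (\<lambda>i k. A (\<phi> i) (\<psi> k) - K i k) x)" for x
        by (intro l2_cong app_cong) (simp add: K'_app)
      then show "op_bound I (\<lambda>i k. A (\<phi> i) (\<psi> k) - K' (\<phi> i) (\<psi> k)) s"
        using K(2) by (simp add: op_bound_def)
    qed
    finally show "singular_value J A j \<le> s" .
  qed
qed

section \<open>Multiplier norms under compression and extension by zeros\<close>

lemma multiplier_norm_supported:
  fixes M :: "'j cmatrix"
  assumes I: "finite I" "inj_on \<phi> I" "\<phi> ` I \<subseteq> J" "inj_on \<psi> I" "\<psi> ` I \<subseteq> J"
    and M: "\<And>a b. \<not> (a \<in> \<phi> ` I \<and> b \<in> \<psi> ` I) \<Longrightarrow> M a b = 0"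
    and p: "0 < p"
  shows "multiplier_norm J p M = multiplier_norm I p (\<lambda>i k. M (\<phi> i) (\<psi> k))"
proof -
  let ?M = "\<lambda>i k. M (\<phi> i) (\<psi> k)"
  have supp: "A \<in> schatten J p" "schatten_norm J p A = schatten_norm I p (\<lambda>i k. A (\<phi> i) (\<psi> k))"
    if A: "\<And>a b. \<not> (a \<in> \<phi> ` I \<and> b \<in> \<psi> ` I) \<Longrightarrow> A a b = 0" for A
    using bounded_mat_supported[OF I A] singular_value_supported[OF I A]
      schatten_finite(1)[OF I(1), of "\<lambda>i k. A (\<phi> i) (\<psi> k)" p]
    by (auto simp: schatten_def schatten_norm_def)
  have MB: "M \<star> B \<in> schatten J p"
    "schatten_norm J p (M \<star> B) = schatten_norm I p (?M \<star> (\<lambda>i k. B (\<phi> i) (\<psi> k)))" for B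
    using supp[of "M \<star> B"] M by (simp_all add: schur_prod_def)
  note fin = schatten_finite(1)[OF I(1)]
  show ?thesis
    unfolding multiplier_norm_def
  proof (rule antisym; rule SUP_mono)
    \<comment> \<open>A test matrix on \<open>J\<close> is compressed to \<open>I\<close>. Its
      quasinorm does not grow, while \<open>M \<star> B\<close> depends only on the entries that are
      kept.\<close>
    fix B assume B: "B \<in> {B \<in> schatten J p. schatten_norm J p B \<le> 1}"
    let ?B = "\<lambda>i k. B (\<phi> i) (\<psi> k)"
    have "bounded_mat J B" and sum: "summable (\<lambda>j. singular_value J B j powr p)"
      using B by (auto simp: schatten_def)
    then have le: "singular_value I ?B j \<le> singular_value J B j" for j
      by (intro singular_value_compress_le I)
    have "(\<Sum>j. singular_value I ?B j powr p) \<le> (\<Sum>j. singular_value J B j powr p)"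
      using fin[of ?B] le p sum singular_value_nonneg[OF I(1)]
      by (intro suminf_le powr_mono2) (auto simp: schatten_def)
    then have "schatten_norm I p ?B \<le> schatten_norm J p B"
      unfolding schatten_norm_def using p fin[of ?B]
      by (intro powr_mono2 suminf_nonneg) (auto simp: schatten_def)
    with B have "?B \<in> {B \<in> schatten I p. schatten_norm I p B \<le> 1}"
      using fin by auto
    then show "\<exists>C\<in>{B \<in> schatten I p. schatten_norm I p B \<le> 1}.
        (if M \<star> B \<in> schatten J p then ennreal (schatten_norm J p (M \<star> B)) else \<infinity>)
        \<le> (if ?M \<star> C \<in> schatten I p then ennreal (schatten_norm I p (?M \<star> C)) else \<infinity>)"
      using MB[of B] fin by (intro bexI[of _ ?B]) auto
  next
    \<comment> \<open>Conversely, a test matrix on \<open>I\<close> is extended by zeros, which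
      preserves its quasinorm.\<close>
    fix B assume B: "B \<in> {B \<in> schatten I p. schatten_norm I p B \<le> 1}"
    define C where "C = (\<lambda>a b. if a \<in> \<phi> ` I \<and> b \<in> \<psi> ` I
      then B (inv_into I \<phi> a) (inv_into I \<psi> b) else 0)"
    have C0: "C a b = 0" if "\<not> (a \<in> \<phi> ` I \<and> b \<in> \<psi> ` I)" for a b
      using that unfolding C_def by auto
    have C: "C (\<phi> i) (\<psi> k) = B i k" if "i \<in> I" "k \<in> I" for i k
      using that I(2,4) by (simp add: C_def)
    have "schatten_norm I p (\<lambda>i k. C (\<phi> i) (\<psi> k)) = schatten_norm I p B"
      unfolding schatten_norm_def
      by (subst singular_value_cong[OF I(1), of _ B]) (auto simp: C)
    with B supp[of C, OF C0] have "C \<in> {B \<in> schatten J p. schatten_norm J p B \<le> 1}"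
      by auto
    moreover have "schatten_norm I p (?M \<star> (\<lambda>i k. C (\<phi> i) (\<psi> k))) = schatten_norm I p (?M \<star> B)"
      unfolding schatten_norm_def
      by (subst singular_value_cong[OF I(1), of _ "?M \<star> B"]) (auto simp: C schur_prod_def)
    ultimately show "\<exists>C\<in>{B \<in> schatten J p. schatten_norm J p B \<le> 1}.
        (if ?M \<star> B \<in> schatten I p then ennreal (schatten_norm I p (?M \<star> B)) else \<infinity>)
        \<le> (if M \<star> C \<in> schatten J p then ennreal (schatten_norm J p (M \<star> C)) else \<infinity>)"
      using MB[of C] fin by (intro bexI[of _ C]) auto
  qed
qed

lemma multiplier_norm_cong:
  assumes "finite I" "\<And>i k. i \<in> I \<Longrightarrow> k \<in> I \<Longrightarrow> M i k = N i k"
  shows "multiplier_norm I p M = multiplier_norm I p N"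
proof -
  have "schatten_norm I p (M \<star> B) = schatten_norm I p (N \<star> B)" for B
    unfolding schatten_norm_def
    by (subst singular_value_cong[OF assms(1), of _ "N \<star> B"]) (auto simp: assms(2) schur_prod_def)
  then show ?thesis
    unfolding multiplier_norm_def by (simp add: schatten_finite(1)[OF assms(1)])
qed

text \<open>Rows are shifted because \<open>Delta\<close> is indexed from \<open>0\<close> and
  \<open>chi\<close> from \<open>1\<close>; columns are reversed. For indices in
  \<open>{1..n}\<close> the condition \<open>(i - 1) + (n - k) < n\<close> says
  \<open>i \<le> k\<close>.\<close>

lemma multiplier_norm_Delta_eq_chi:
  assumes "0 < p"
  shows "multiplier_norm UNIV p (Delta n) = multiplier_norm {1..n} p chi"
proof -
  let ?\<phi> = "\<lambda>j. j - 1 :: nat" and ?\<psi> = "\<lambda>k. n - k"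
  have img: "a \<in> ?\<phi> ` {1..n} \<and> b \<in> ?\<psi> ` {1..n}" if "a + b < n" for a b
    using that by (intro conjI image_eqI[of a _ "a + 1"] image_eqI[of b _ "n - b"]) auto
  have "multiplier_norm UNIV p (Delta n) = multiplier_norm {1..n} p (\<lambda>i k. Delta n (?\<phi> i) (?\<psi> k))"
  proof (rule multiplier_norm_supported)
    show "Delta n a b = 0" if "\<not> (a \<in> ?\<phi> ` {1..n} \<and> b \<in> ?\<psi> ` {1..n})" for a b
      using that img[of a b] by (auto simp: Delta_def)
  qed (use assms in \<open>auto simp: inj_on_def\<close>)
  also have "\<dots> = multiplier_norm {1..n} p chi"
    by (rule multiplier_norm_cong) (auto simp: Delta_def chi_def)
  finally show ?thesis .
qed

subsection \<open>The lower bound\<close>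

text \<open>A homogeneous system with fewer equations than unknowns has a nonzero solution. The
  induction is Gaussian elimination: an unknown \<open>i0\<close> with nonzero coefficient in the
  last equation is eliminated from the others. The pairing is bilinear, without conjugation.\<close>

lemma orthogonal_vector_exists:
  fixes u :: "nat \<Rightarrow> 'i \<Rightarrow> complex"
  assumes "finite I" "j < card I"
  shows "\<exists>w. (\<exists>i\<in>I. w i \<noteq> 0) \<and> (\<forall>m<j. (\<Sum>i\<in>I. w i * u m i) = 0)"
  using assms
proof (induction j arbitrary: I u)
  case 0
  then have "I \<noteq> {}" by auto
  then show ?case by (intro exI[of _ "\<lambda>_. 1"]) auto
next
  case (Suc j)
  show ?case
  proof (cases "\<forall>i\<in>I. u j i = 0")
    case True
    obtain w where w: "\<exists>i\<in>I. w i \<noteq> 0" "\<forall>m<j. (\<Sum>i\<in>I. w i * u m i) = 0"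
      using Suc.IH[OF Suc.prems(1) Suc_lessD[OF Suc.prems(2)], of u] by blast
    moreover have "(\<Sum>i\<in>I. w i * u j i) = 0"
      using True by simp
    ultimately show ?thesis
      unfolding less_Suc_eq by (intro exI[of _ w]) blast
  next
    case False
    then obtain i0 where i0: "i0 \<in> I" "u j i0 \<noteq> 0" by blast
    define I' where "I' = I - {i0}"
    have I': "finite I'" "j < card I'"
      using Suc.prems i0(1) by (auto simp: I'_def)
    obtain w where w: "\<exists>i\<in>I'. w i \<noteq> 0"
        "\<And>m. m < j \<Longrightarrow> (\<Sum>i\<in>I'. w i * (u m i - u m i0 / u j i0 * u j i)) = 0"
      using Suc.IH[OF I', of "\<lambda>m i. u m i - u m i0 / u j i0 * u j i"] by blast
    define S where "S = (\<Sum>i\<in>I'. w i * u j i)"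
    \<comment> \<open>The value at \<open>i0\<close> is the one that solves equation
      \<open>j\<close>.\<close>
    let ?w = "\<lambda>i. if i = i0 then - S / u j i0 else w i"
    have split: "(\<Sum>i\<in>I. ?w i * u m i) = - S / u j i0 * u m i0 + (\<Sum>i\<in>I'. w i * u m i)" for m
    proof -
      have "(\<Sum>i\<in>I. ?w i * u m i) = ?w i0 * u m i0 + (\<Sum>i\<in>I'. ?w i * u m i)"
        unfolding I'_def by (rule sum.remove[OF Suc.prems(1) i0(1)])
      also have "(\<Sum>i\<in>I'. ?w i * u m i) = (\<Sum>i\<in>I'. w i * u m i)"
        by (rule sum.cong) (auto simp: I'_def)
      finally show ?thesis by simp
    qed
    have "(\<Sum>i\<in>I. ?w i * u m i) = 0" if "m < Suc j" for m
    proof (cases "m = j")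
      case True
      then show ?thesis using i0(2) unfolding split by (simp add: S_def)
    next
      case False
      with that have "m < j" by simp
      from w(2)[OF this]
      have "(\<Sum>i\<in>I'. w i * u m i) = (\<Sum>i\<in>I'. w i * u j i * (u m i0 / u j i0))"
        by (simp add: right_diff_distrib sum_subtractf mult_ac)
      also have "\<dots> = S * (u m i0 / u j i0)"
        unfolding S_def by (rule sum_distrib_right[symmetric])
      finally show ?thesis
        unfolding split by simp
    qed
    moreover obtain i where "i \<in> I" "i \<noteq> i0" "w i \<noteq> 0"
      using w(1) unfolding I'_def by blast
    then have "\<exists>i\<in>I. ?w i \<noteq> 0"
      by (intro bexI[of _ i]) simp_all
    ultimately show ?thesis
      by (intro exI[of _ ?w] conjI allI impI)
  qed
qed

text \<open>
  The inverse of \<open>\<chi>\<^sub>n\<close> is the identity minus a shift, so it has norm at most \<open>2\<close>; hence all \<open>n\<close>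
  singular values of \<open>\<chi>\<^sub>n\<close> are at least \<open>1/2\<close>.
\<close>

lemma singular_value_chi_ge:
  assumes "j < n" "0 \<le> c"
  shows "c / 2 \<le> singular_value {1..n} (\<lambda>i k. complex_of_real c * chi i k) j"
proof (rule singular_value_ge)
  fix K s
  assume K: "rank_le {1..n} K j"
    and s: "op_bound {1..n} (\<lambda>i k. complex_of_real c * chi i k - K i k) s" "0 \<le> s"
  let ?I = "{1..n}"
  obtain u where u: "\<And>x. \<exists>d :: nat \<Rightarrow> _. \<forall>i\<in>?I. app ?I K x i = (\<Sum>m<j. d m * u m i)"
    using K by (auto simp: rank_le_finite_iff)
  obtain w where w: "\<exists>i\<in>?I. w i \<noteq> 0" "\<And>m. m < j \<Longrightarrow> (\<Sum>i\<in>?I. w i * u m i) = 0"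
    using orthogonal_vector_exists[of ?I j u] assms(1) by auto
  \<comment> \<open>\<open>w\<close> annihilates the range of \<open>K\<close>. The vector
    \<open>x\<close> is the preimage under \<open>chi\<close> of the conjugate of \<open>w\<close>;
    the value \<open>0\<close> of \<open>W\<close> at \<open>n + 1\<close> lets the telescoping sum
    end correctly.\<close>
  define W where "W = (\<lambda>k. if k \<in> ?I then cnj (w k) else 0)"
  define x where "x = (\<lambda>k. W k - W (k + 1))"
  have chi_x: "app ?I chi x i = W i" if "i \<in> ?I" for i
  proof -
    have "app ?I chi x i = (\<Sum>k=i..n. W k - W (Suc k))"
      using that by (intro sum.mono_neutral_cong_right) (auto simp: chi_def x_def)
    also have "\<dots> = W i - W (Suc n)"
      using that sum_Suc_diff[of i n "\<lambda>k. - W k"] by simp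
    finally show ?thesis by (simp add: W_def)
  qed
  have K_x: "(\<Sum>i\<in>?I. w i * app ?I K x i) = 0"
  proof -
    obtain d where d: "\<forall>i\<in>?I. app ?I K x i = (\<Sum>m<j. d m * u m i)" using u by blast
    have "(\<Sum>i\<in>?I. w i * app ?I K x i) = (\<Sum>i\<in>?I. \<Sum>m<j. d m * (w i * u m i))"
      using d by (intro sum.cong refl) (simp add: sum_distrib_left mult.left_commute del: sum.cong)
    also have "\<dots> = (\<Sum>m<j. d m * (\<Sum>i\<in>?I. w i * u m i))"
      by (subst sum.swap) (simp add: sum_distrib_left)
    finally show ?thesis using w(2) by simp
  qed
  have W_norm: "l2 ?I W = l2 ?I w"
    by (rule L2_set_cong) (auto simp: W_def)
  \<comment> \<open>The shift is a contraction: the shifted sum runs over \<open>2..n+1\<close>, and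
    \<open>W\<close> vanishes at \<open>n + 1\<close>.\<close>
  have "(l2 ?I (\<lambda>k. - W (k + 1)))\<^sup>2 = (\<Sum>k=1..n. (cmod (W (Suc k)))\<^sup>2)"
    by (simp only: l2_power2 norm_minus_cancel Suc_eq_plus1)
  also have "\<dots> = (\<Sum>k=Suc 1..Suc n. (cmod (W k))\<^sup>2)"
    by (rule sum.shift_bounds_cl_Suc_ivl[symmetric])
  also have "\<dots> \<le> (\<Sum>k=1..Suc n. (cmod (W k))\<^sup>2)"
    by (rule sum_mono2) auto
  also have "\<dots> = (l2 ?I W)\<^sup>2"
    by (simp add: l2_power2 W_def)
  finally have "l2 ?I (\<lambda>k. - W (k + 1)) \<le> l2 ?I W"
    by (rule power2_le_imp_le) simp
  then have x_norm: "l2 ?I x \<le> 2 * l2 ?I w"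
    using l2_add_le[where I = ?I and x = W and y = "\<lambda>k. - W (k + 1)"] W_norm
    by (simp add: x_def)
  have pos: "0 < l2 ?I w"
    using w(1) by (auto simp: less_le L2_set_eq_0_iff)
  \<comment> \<open>Pairing \<open>w\<close> with the image of \<open>x\<close> under the difference
    removes \<open>K\<close> and leaves \<open>c\<close> times the squared norm of \<open>w\<close>.
    Cauchy-Schwarz and the bound on \<open>x\<close> then force
    \<open>c \<le> 2 * s\<close>.\<close>
  have "complex_of_real (c * (l2 ?I w)\<^sup>2)
      = complex_of_real c * (\<Sum>i\<in>?I. complex_of_real ((cmod (w i))\<^sup>2))"
    by (simp only: l2_power2 of_real_mult of_real_sum)
  also have "\<dots> = (\<Sum>i\<in>?I. complex_of_real c * complex_of_real ((cmod (w i))\<^sup>2))"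
    by (rule sum_distrib_left)
  also have "\<dots> = (\<Sum>i\<in>?I. w i * (complex_of_real c * app ?I chi x i))"
  proof (rule sum.cong)
    fix i assume i: "i \<in> ?I"
    then have "w i * (complex_of_real c * app ?I chi x i) = complex_of_real c * (w i * cnj (w i))"
      by (subst chi_x[OF i]) (simp add: W_def)
    then show "complex_of_real c * complex_of_real ((cmod (w i))\<^sup>2)
        = w i * (complex_of_real c * app ?I chi x i)"
      by (simp only: complex_norm_square)
  qed simp
  also have "\<dots> = (\<Sum>i\<in>?I. w i * (complex_of_real c * app ?I chi x i)) - (\<Sum>i\<in>?I. w i * app ?I K x i)"
    by (simp only: K_x) simp
  also have "\<dots> = (\<Sum>i\<in>?I. w i * app ?I (\<lambda>i k. complex_of_real c * chi i k - K i k) x i)"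
    by (simp add: sum_subtractf[symmetric] sum_distrib_left algebra_simps)
  finally have "c * (l2 ?I w)\<^sup>2
      = cmod (\<Sum>i\<in>?I. w i * app ?I (\<lambda>i k. complex_of_real c * chi i k - K i k) x i)"
    using assms(2) norm_of_real[of "c * (l2 ?I w)\<^sup>2", where 'a = complex] by simp
  also have "\<dots> \<le> l2 ?I w * l2 ?I (app ?I (\<lambda>i k. complex_of_real c * chi i k - K i k) x)"
    by (rule cmod_sum_mult_le)
  also have "\<dots> \<le> l2 ?I w * (s * l2 ?I x)"
    using s(1) unfolding op_bound_def by (intro mult_left_mono) auto
  also have "\<dots> \<le> l2 ?I w * (s * (2 * l2 ?I w))"
    using s(2) x_norm by (intro mult_left_mono) auto
  finally have "c * (l2 ?I w)\<^sup>2 \<le> (2 * s) * (l2 ?I w)\<^sup>2"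
    by (simp add: power2_eq_square mult_ac)
  then show "c / 2 \<le> s"
    using pos by simp
qed simp

text \<open>The test matrix \<open>?B\<close> has rank one and norm at most \<open>1\<close>, so
  only its singular value of index \<open>0\<close> contributes. Its Schur product with
  \<open>chi\<close> has \<open>n\<close> singular values of size at least
  \<open>1 / (2 * n)\<close>, which gives a quasinorm of at least
  \<open>n powr (1 / p) / (2 * n)\<close>.\<close>

lemma multiplier_norm_chi_ge:
  assumes p: "0 < p" and n: "1 \<le> n"
  shows "ennreal (1 / 2 * real n powr (1 / p - 1)) \<le> multiplier_norm {1..n} p chi"
proof -
  let ?I = "{1..n}" and ?B = "\<lambda>_ _. complex_of_real (1 / n)"
  have B_bound: "op_bound ?I ?B 1"
    unfolding op_bound_def
  proof
    fix x
    have ones: "l2 ?I (\<lambda>_. 1) = sqrt n"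
      by (simp add: L2_set_def)
    have "l2 ?I (app ?I ?B x) = cmod (app ?I ?B x 1) * l2 ?I (\<lambda>_. 1)"
      using l2_mult[where I = ?I and c = "app ?I ?B x 1" and x = "\<lambda>_. 1"] by simp
    also have "cmod (app ?I ?B x 1) \<le> l2 ?I (\<lambda>_. complex_of_real (1 / n) * 1) * l2 ?I x"
      using cmod_sum_mult_le[where I = ?I and x = "\<lambda>_. complex_of_real (1 / n)" and y = x] by simp
    also have "l2 ?I (\<lambda>_. complex_of_real (1 / n) * 1) = sqrt n / n"
      unfolding l2_mult ones norm_of_real by simp
    finally have "l2 ?I (app ?I ?B x) \<le> sqrt n / n * l2 ?I x * l2 ?I (\<lambda>_. 1)"
      by (simp add: mult_right_mono)
    also have "\<dots> = l2 ?I x"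
      unfolding ones sqrt_divide_self_eq[OF of_nat_0_le_iff] using n by (simp add: field_simps)
    finally show "l2 ?I (app ?I ?B x) \<le> 1 * l2 ?I x"
      by simp
  qed
  have "singular_value ?I ?B 0 \<le> 1"
    using B_bound by (intro singular_value_le[of ?I "\<lambda>_ _. 0"] rank_le_zero) auto
  moreover have "singular_value ?I ?B j = 0" if "j \<noteq> 0" for j
    using that rank_le_rank_one[of ?I "\<lambda>_. complex_of_real (1 / n)" "\<lambda>_. 1"]
    by (intro singular_value_eq_0[of ?I _ 1]) auto
  ultimately have "singular_value ?I ?B j powr p \<le> (if j = 0 then 1 else 0)" for j
    using p singular_value_nonneg[of ?I ?B j] by (cases "j = 0") (auto simp: powr_le1)
  then have "(\<Sum>j<n. singular_value ?I ?B j powr p) \<le> (\<Sum>j<n. if j = 0 then 1 else 0)"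
    by (rule sum_mono)
  also have "\<dots> = 1"
    using n by simp
  finally have B: "schatten_norm ?I p ?B \<le> 1"
    using p by (subst schatten_finite(2)) (auto intro!: powr_le1 simp: abs_of_nonneg sum_nonneg)
  define a where "a = 1 / real n / 2"
  have a: "0 < a" using n by (simp add: a_def)
  have "1 / 2 * real n powr (1 / p - 1) = a * real n powr (1 / p)"
    using n by (simp add: powr_diff a_def)
  also have "\<dots> = (a powr p) powr (1 / p) * real n powr (1 / p)"
    using a p by (simp add: powr_powr)
  also have "\<dots> = (a powr p * n) powr (1 / p)"
    by (simp add: powr_mult)
  also have "\<dots> = (\<Sum>j<n. a powr p) powr (1 / p)"
    by (simp add: mult.commute)
  also have "\<dots> \<le> (\<Sum>j<n. singular_value ?I (chi \<star> ?B) j powr p) powr (1 / p)"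
  proof (intro powr_mono2 sum_mono sum_nonneg)
    have eq: "chi \<star> ?B = (\<lambda>i k. complex_of_real (1 / n) * chi i k)"
      by (simp add: schur_prod_def fun_eq_iff)
    show "a \<le> singular_value ?I (chi \<star> ?B) j" if "j \<in> {..<n}" for j
      unfolding eq a_def using that by (intro singular_value_chi_ge) auto
  qed (use a p in auto)
  also have "\<dots> = schatten_norm ?I p (chi \<star> ?B)"
    by (subst schatten_finite(2)) simp_all
  finally have "ennreal (1 / 2 * real n powr (1 / p - 1)) \<le> ennreal (schatten_norm ?I p (chi \<star> ?B))"
    by (rule ennreal_leI)
  also have "\<dots> = (if chi \<star> ?B \<in> schatten ?I p then ennreal (schatten_norm ?I p (chi \<star> ?B)) else \<infinity>)"
    using schatten_finite(1)[of ?I "chi \<star> ?B" p] by simp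
  also have "\<dots> \<le> multiplier_norm ?I p chi"
    unfolding multiplier_norm_def
    by (rule SUP_upper) (use B schatten_finite(1)[of ?I ?B p] in simp)
  finally show ?thesis .
qed

subsection \<open>Sums of rank one matrices\<close>

lemma op_bound_mono: "op_bound I A s \<Longrightarrow> s \<le> t \<Longrightarrow> op_bound I A t"
  unfolding op_bound_def by (meson L2_set_nonneg mult_right_mono order_trans)

lemma op_bound_cong:
  assumes "op_bound I A s" "\<And>i k. i \<in> I \<Longrightarrow> k \<in> I \<Longrightarrow> A i k = B i k"
  shows "op_bound I B s"
proof -
  have "l2 I (app I A x) = l2 I (app I B x)" for x
    by (intro l2_cong app_cong) (simp add: assms(2))
  with assms(1) show ?thesis
    by (simp add: op_bound_def)
qed

lemma op_bound_add:
  assumes "op_bound I A s" "op_bound I B t"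
  shows "op_bound I (\<lambda>i k. A i k + B i k) (s + t)"
  unfolding op_bound_def
proof
  fix x
  have "l2 I (app I (\<lambda>i k. A i k + B i k) x) = l2 I (\<lambda>i. app I A x i + app I B x i)"
    by (rule l2_cong) (simp add: distrib_right sum.distrib)
  also have "\<dots> \<le> l2 I (app I A x) + l2 I (app I B x)"
    by (rule l2_add_le)
  also have "\<dots> \<le> s * l2 I x + t * l2 I x"
    using assms unfolding op_bound_def by (intro add_mono) blast+
  finally show "l2 I (app I (\<lambda>i k. A i k + B i k) x) \<le> (s + t) * l2 I x"
    by (simp add: distrib_right)
qed

lemma op_bound_uminus:
  assumes "op_bound I A s"
  shows "op_bound I (\<lambda>i k. - A i k) s"
proof -
  have "l2 I (app I (\<lambda>i k. - A i k) x) = l2 I (app I A x)" for x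
    by (rule L2_set_cong) (simp_all add: sum_negf)
  with assms show ?thesis
    by (simp add: op_bound_def)
qed

lemma op_bound_rank_one: "op_bound I (\<lambda>i k. u i * v k) (l2 I u * l2 I v)"
  unfolding op_bound_def
proof
  fix x
  have "l2 I (app I (\<lambda>i k. u i * v k) x) = l2 I (\<lambda>i. (\<Sum>k\<in>I. v k * x k) * u i)"
    by (rule l2_cong) (simp add: sum_distrib_left sum_distrib_right mult_ac)
  also have "\<dots> = cmod (\<Sum>k\<in>I. v k * x k) * l2 I u"
    by (rule l2_mult)
  also have "\<dots> \<le> (l2 I v * l2 I x) * l2 I u"
    by (intro mult_right_mono cmod_sum_mult_le) simp
  finally show "l2 I (app I (\<lambda>i k. u i * v k) x) \<le> l2 I u * l2 I v * l2 I x"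
    by (simp add: mult_ac)
qed

lemma op_bound_sum_rank_one:
  "op_bound I (\<lambda>i k. \<Sum>m\<in>F. u m i * v m k) (\<Sum>m\<in>F. l2 I (u m) * l2 I (v m))"
proof (induction F rule: infinite_finite_induct)
  case (insert m F)
  with op_bound_add[OF op_bound_rank_one[of I "u m" "v m"] insert.IH] show ?case
    by simp
qed (simp_all add: op_bound_def L2_set_def)

section \<open>Deflation and weak type bounds for sums of rank one matrices\<close>

lemma l2_project:
  fixes u e :: "'i \<Rightarrow> complex"
  assumes "l2 I e = 1"
  defines "\<alpha> \<equiv> \<Sum>i\<in>I. u i * cnj (e i)"
  shows "(l2 I (\<lambda>i. u i - \<alpha> * e i))\<^sup>2 = (l2 I u)\<^sup>2 - (cmod \<alpha>)\<^sup>2"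
    and "cmod \<alpha> \<le> l2 I u"
proof -
  have sq: "complex_of_real ((l2 I x)\<^sup>2) = (\<Sum>i\<in>I. x i * cnj (x i))" for x
    unfolding l2_power2 of_real_sum complex_norm_square ..
  have e1: "(\<Sum>i\<in>I. e i * cnj (e i)) = 1"
    unfolding sq[of e, symmetric] assms(1) by simp
  have \<alpha>': "(\<Sum>i\<in>I. e i * cnj (u i)) = cnj \<alpha>"
    unfolding \<alpha>_def by (simp add: mult.commute)
  have "complex_of_real ((l2 I (\<lambda>i. u i - \<alpha> * e i))\<^sup>2)
      = (\<Sum>i\<in>I. u i * cnj (u i) - \<alpha> * (e i * cnj (u i)) - cnj \<alpha> * (u i * cnj (e i))
          + \<alpha> * cnj \<alpha> * (e i * cnj (e i)))"
    unfolding sq by (rule sum.cong) (simp_all add: algebra_simps)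
  also have "\<dots> = (\<Sum>i\<in>I. u i * cnj (u i)) - \<alpha> * (\<Sum>i\<in>I. e i * cnj (u i))
      - cnj \<alpha> * (\<Sum>i\<in>I. u i * cnj (e i)) + \<alpha> * cnj \<alpha> * (\<Sum>i\<in>I. e i * cnj (e i))"
    by (simp add: sum.distrib sum_subtractf sum_distrib_left)
  also have "\<dots> = complex_of_real ((l2 I u)\<^sup>2) - \<alpha> * cnj \<alpha>"
    unfolding e1 \<alpha>' sq \<alpha>_def[symmetric] by simp
  also have "\<dots> = complex_of_real ((l2 I u)\<^sup>2 - (cmod \<alpha>)\<^sup>2)"
    by (simp only: complex_norm_square of_real_diff)
  finally show eq: "(l2 I (\<lambda>i. u i - \<alpha> * e i))\<^sup>2 = (l2 I u)\<^sup>2 - (cmod \<alpha>)\<^sup>2"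
    by (simp only: of_real_eq_iff)
  have "(cmod \<alpha>)\<^sup>2 \<le> (l2 I u)\<^sup>2"
    using eq zero_le_power2[of "l2 I (\<lambda>i. u i - \<alpha> * e i)"] by linarith
  then show "cmod \<alpha> \<le> l2 I u"
    by (rule power2_le_imp_le) simp
qed

text \<open>With \<open>a, b\<close> the norms and \<open>c, d\<close> the moduli of the
  coefficients, Pythagoras gives the squared left side as \<open>(a^2 - c^2) * (b^2 - d^2) = (a * b
  - c * d)^2 - (a * d - b * c)^2\<close>. Thus projecting lowers the size of a rank one term by at
  least \<open>c * d\<close>.\<close>

lemma l2_project_mult_le:
  fixes u v e f :: "'i \<Rightarrow> complex"
  assumes "l2 I e = 1" "l2 I f = 1"
  defines "\<alpha> \<equiv> \<Sum>i\<in>I. u i * cnj (e i)" and "\<beta> \<equiv> \<Sum>i\<in>I. v i * cnj (f i)"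
  shows "l2 I (\<lambda>i. u i - \<alpha> * e i) * l2 I (\<lambda>i. v i - \<beta> * f i) \<le> l2 I u * l2 I v - cmod \<alpha> * cmod \<beta>"
proof (rule power2_le_imp_le)
  let ?a = "l2 I u" and ?b = "l2 I v" and ?c = "cmod \<alpha>" and ?d = "cmod \<beta>"
  have "(l2 I (\<lambda>i. u i - \<alpha> * e i) * l2 I (\<lambda>i. v i - \<beta> * f i))\<^sup>2 = (?a\<^sup>2 - ?c\<^sup>2) * (?b\<^sup>2 - ?d\<^sup>2)"
    unfolding power_mult_distrib \<alpha>_def \<beta>_def l2_project(1)[OF assms(1)] l2_project(1)[OF assms(2)] ..
  also have "\<dots> = (?a * ?b - ?c * ?d)\<^sup>2 - (?a * ?d - ?b * ?c)\<^sup>2"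
    by (simp add: power2_eq_square algebra_simps)
  also have "\<dots> \<le> (?a * ?b - ?c * ?d)\<^sup>2"
    by simp
  finally show "(l2 I (\<lambda>i. u i - \<alpha> * e i) * l2 I (\<lambda>i. v i - \<beta> * f i))\<^sup>2 \<le> (?a * ?b - ?c * ?d)\<^sup>2" .
  have "?c * ?d \<le> ?a * ?b"
    unfolding \<alpha>_def \<beta>_def using l2_project(2)[OF assms(1), of u] l2_project(2)[OF assms(2), of v]
    by (intro mult_mono) auto
  then show "0 \<le> ?a * ?b - ?c * ?d" by simp
qed

text \<open>
  Greedy deflation: as long as some unit vector is stretched by more than \<open>t\<close>, projecting off this
  vector and its image is a perturbation of rank at most \<open>2\<close>, and it lowers
  \<open>\<Sum>\<parallel>u\<^sub>m\<parallel>\<parallel>v\<^sub>m\<parallel>\<close> by more than \<open>t\<close>.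
\<close>

lemma low_rank_approximation:
  fixes u v :: "'m \<Rightarrow> 'i \<Rightarrow> complex"
  assumes "finite I" "0 \<le> t" "(\<Sum>m\<in>F. l2 I (u m) * l2 I (v m)) \<le> real k * t"
  shows "\<exists>K. rank_le I K (2 * k) \<and> op_bound I (\<lambda>i j. (\<Sum>m\<in>F. u m i * v m j) - K i j) t"
  using assms(3)
proof (induction k arbitrary: u v)
  case 0
  then have "op_bound I (\<lambda>i j. \<Sum>m\<in>F. u m i * v m j) t"
    using assms(2) by (intro op_bound_mono[OF op_bound_sum_rank_one]) simp
  moreover have "rank_le I (\<lambda>_ _. 0) 0"
    using assms(1) by (intro rank_le_zero) simp_all
  ultimately show ?case
    by (intro exI[of _ "\<lambda>_ _. 0"]) simp
next
  case (Suc k)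
  define T where "T = (\<lambda>i j. \<Sum>m\<in>F. u m i * v m j)"
  show ?case
  proof (cases "op_bound I T t")
    case True
    have "rank_le I (\<lambda>_ _. 0) (2 * Suc k)"
      by (rule rank_le_mono[OF assms(1) rank_le_zero[OF assms(1)]]) simp_all
    with True show ?thesis
      by (intro exI[of _ "\<lambda>_ _. 0"]) (simp add: T_def)
  next
    case False
    then obtain x where x: "t * l2 I x < l2 I (app I T x)"
      unfolding op_bound_def not_all not_le by blast
    have "l2 I (app I T x) \<le> (\<Sum>m\<in>F. l2 I (u m) * l2 I (v m)) * l2 I x"
      using op_bound_sum_rank_one[where F = F and u = u and v = v and I = I]
      unfolding T_def op_bound_def by blast
    with x have "l2 I x \<noteq> 0"
      by auto
    then have h: "0 < l2 I x" by (simp add: less_le)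
    have "0 \<le> t * l2 I x"
      using assms(2) by simp
    with x have g: "0 < l2 I (app I T x)" by linarith
    \<comment> \<open>\<open>e\<close> is the normalised image of \<open>x\<close>. The conjugate in
      \<open>f\<close> makes \<open>\<beta> m\<close> the plain sum of \<open>v m i * x i\<close>,
      divided by the norm of \<open>x\<close>.\<close>
    define e where "e = (\<lambda>i. complex_of_real (1 / l2 I (app I T x)) * app I T x i)"
    define f where "f = (\<lambda>i. complex_of_real (1 / l2 I x) * cnj (x i))"
    have e1: "l2 I e = 1"
      unfolding e_def l2_mult norm_of_real using g by simp
    have f1: "l2 I f = 1"
      unfolding f_def l2_mult norm_of_real using h by simp
    define \<alpha> where "\<alpha> = (\<lambda>m. \<Sum>i\<in>I. u m i * cnj (e i))"
    define \<beta> where "\<beta> = (\<lambda>m. \<Sum>i\<in>I. v m i * cnj (f i))"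
    define u' where "u' = (\<lambda>m i. u m i - \<alpha> m * e i)"
    define v' where "v' = (\<lambda>m i. v m i - \<beta> m * f i)"
    \<comment> \<open>The inner product of the image of \<open>x\<close> with \<open>e\<close> is
      computed twice: as the norm of this image, and term by term from the decomposition.\<close>
    have eq: "complex_of_real (l2 I (app I T x) / l2 I x) = (\<Sum>m\<in>F. \<alpha> m * \<beta> m)"
    proof -
      have app: "app I T x i = (\<Sum>m\<in>F. complex_of_real (l2 I x) * \<beta> m * u m i)" for i
      proof -
        have "app I T x i = (\<Sum>m\<in>F. \<Sum>k\<in>I. u m i * v m k * x k)"
          unfolding T_def sum_distrib_right by (rule sum.swap)
        also have "\<dots> = (\<Sum>m\<in>F. complex_of_real (l2 I x) * \<beta> m * u m i)"
          using h unfolding \<beta>_def f_def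
          by (intro sum.cong refl) (simp add: sum_distrib_left sum_distrib_right mult_ac)
        finally show ?thesis .
      qed
      have "complex_of_real ((l2 I (app I T x))\<^sup>2) = (\<Sum>i\<in>I. app I T x i * cnj (app I T x i))"
        unfolding l2_power2 of_real_sum complex_norm_square ..
      also have "\<dots> = (\<Sum>i\<in>I. complex_of_real (l2 I (app I T x)) * (app I T x i * cnj (e i)))"
        using g unfolding e_def by (intro sum.cong refl) simp
      also have "\<dots> = complex_of_real (l2 I (app I T x)) * (\<Sum>i\<in>I. app I T x i * cnj (e i))"
        by (rule sum_distrib_left[symmetric])
      also have "(\<Sum>i\<in>I. app I T x i * cnj (e i))
          = (\<Sum>i\<in>I. \<Sum>m\<in>F. complex_of_real (l2 I x) * \<beta> m * u m i * cnj (e i))"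
        unfolding app sum_distrib_right ..
      also have "\<dots> = (\<Sum>m\<in>F. \<Sum>i\<in>I. complex_of_real (l2 I x) * \<beta> m * u m i * cnj (e i))"
        by (rule sum.swap)
      also have "\<dots> = complex_of_real (l2 I x) * (\<Sum>m\<in>F. \<alpha> m * \<beta> m)"
        unfolding \<alpha>_def by (simp add: sum_distrib_left sum_distrib_right mult_ac)
      finally show ?thesis
        using g h by (simp add: power2_eq_square field_simps)
    qed
    have "t \<le> l2 I (app I T x) / l2 I x"
      using x h by (simp add: le_divide_eq)
    also have "l2 I (app I T x) / l2 I x = cmod (\<Sum>m\<in>F. \<alpha> m * \<beta> m)"
      using g h by (simp only: eq[symmetric] norm_of_real) simp
    also have "\<dots> \<le> (\<Sum>m\<in>F. cmod (\<alpha> m) * cmod (\<beta> m))"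
      by (rule order_trans[OF norm_sum]) (simp add: norm_mult)
    finally have "t \<le> (\<Sum>m\<in>F. cmod (\<alpha> m) * cmod (\<beta> m))" .
    moreover have "(\<Sum>m\<in>F. l2 I (u' m) * l2 I (v' m))
        \<le> (\<Sum>m\<in>F. l2 I (u m) * l2 I (v m) - cmod (\<alpha> m) * cmod (\<beta> m))"
      unfolding u'_def v'_def \<alpha>_def \<beta>_def by (intro sum_mono l2_project_mult_le e1 f1)
    ultimately have "(\<Sum>m\<in>F. l2 I (u' m) * l2 I (v' m)) \<le> real k * t"
      using Suc.prems by (simp add: sum_subtractf algebra_simps)
    from Suc.IH[OF this] obtain K where K: "rank_le I K (2 * k)"
        "op_bound I (\<lambda>i j. (\<Sum>m\<in>F. u' m i * v' m j) - K i j) t"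
      by blast
    \<comment> \<open>Termwise,
      \<open>u * v = \<alpha> * e * v + \<beta> * u' * f + u' * v'\<close>. Summed over
      \<open>F\<close>, the first two products are rank one matrices, because \<open>e\<close> and
      \<open>f\<close> do not depend on \<open>m\<close>.\<close>
    define R where "R = (\<lambda>i j. e i * (\<Sum>m\<in>F. \<alpha> m * v m j) + (\<Sum>m\<in>F. \<beta> m * u' m i) * f j)"
    have "rank_le I R (1 + 1)"
      unfolding R_def using assms(1) by (intro rank_le_add rank_le_rank_one)
    then have "rank_le I (\<lambda>i j. R i j + K i j) (1 + 1 + 2 * k)"
      using assms(1) K(1) by (intro rank_le_add)
    moreover have "(\<Sum>m\<in>F. u m i * v m j) = R i j + (\<Sum>m\<in>F. u' m i * v' m j)" for i j
      unfolding R_def u'_def v'_def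
      by (simp add: sum_distrib_left sum_distrib_right flip: sum.distrib) (simp add: algebra_simps)
    ultimately show ?thesis
      using K(2) by (intro exI[of _ "\<lambda>i j. R i j + K i j"]) simp
  qed
qed

text \<open>Each term satisfies \<open>c = c powr q * c powr (1 - q) \<le> c powr q * t powr (1 -
  q)\<close>.\<close>

lemma sum_le_of_sum_powr_le:
  fixes c :: "'m \<Rightarrow> real"
  assumes "0 < q" "q < 1" "\<And>m. m \<in> F \<Longrightarrow> 0 \<le> c m" "\<And>m. m \<in> F \<Longrightarrow> c m \<le> t" "0 < t"
    and "(\<Sum>m\<in>F. c m powr q) \<le> r * t powr q"
  shows "(\<Sum>m\<in>F. c m) \<le> r * t"
proof -
  have "(\<Sum>m\<in>F. c m) \<le> (\<Sum>m\<in>F. c m powr q * t powr (1 - q))"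
  proof (rule sum_mono)
    fix m assume m: "m \<in> F"
    show "c m \<le> c m powr q * t powr (1 - q)"
    proof (cases "c m = 0")
      case False
      then have "c m = c m powr q * c m powr (1 - q)"
        using assms(3)[OF m] by (simp flip: powr_add)
      also have "\<dots> \<le> c m powr q * t powr (1 - q)"
        using assms(2) assms(3,4)[OF m] by (intro mult_left_mono powr_mono2) auto
      finally show ?thesis .
    qed simp
  qed
  also have "\<dots> \<le> r * t powr q * t powr (1 - q)"
    unfolding sum_distrib_right[symmetric] using assms(6) by (rule mult_right_mono) simp
  also have "\<dots> = r * t"
    using assms(5) by (simp add: mult.assoc flip: powr_add)
  finally show ?thesis .
qed

text \<open>Put \<open>r = j div 3\<close> and choose \<open>t\<close> with
  \<open>t powr q = A / r\<close>. At most \<open>r\<close> terms exceed \<open>t\<close>, and they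
  go into the approximant as they are. The others have sizes adding up to at most
  \<open>r * t\<close>, so deflation with rank \<open>2 * r\<close> leaves an error of at most
  \<open>t\<close>. The total rank is at most \<open>3 * r \<le> j\<close>, and
  \<open>j + 1 \<le> 6 * r\<close> produces the constant \<open>6\<close>.\<close>

lemma singular_value_sum_rank_one_le:
  fixes u v :: "'m \<Rightarrow> 'i \<Rightarrow> complex"
  assumes "finite I" "finite F" "0 < q" "q < 1" "0 < A"
    and A: "(\<Sum>m\<in>F. (l2 I (u m) * l2 I (v m)) powr q) \<le> A"
  shows "singular_value I (\<lambda>i k. \<Sum>m\<in>F. u m i * v m k) j \<le> (6 * A / (real j + 1)) powr (1 / q)"
proof -
  let ?c = "\<lambda>m. l2 I (u m) * l2 I (v m)" and ?T = "\<lambda>i k. \<Sum>m\<in>F. u m i * v m k"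
  have powr_q: "(a powr (1 / q)) powr q = a" if "0 < a" for a
    using that assms(3) by (simp add: powr_powr)
  have le: "a powr (1 / q) \<le> b powr (1 / q)" if "0 \<le> a" "a \<le> b" for a b
    using that assms(3) by (intro powr_mono2) auto
  show ?thesis
  \<comment> \<open>Here \<open>r\<close> would be \<open>0\<close>; the norm bound
    \<open>A powr (1 / q)\<close> for the whole sum is enough.\<close>
  proof (cases "j < 3")
    case True
    define t where "t = A powr (1 / q)"
    have t: "0 < t" "t powr q = A"
      using assms(5) powr_q by (simp_all add: t_def)
    have c_le: "?c m \<le> t" if "m \<in> F" for m
    proof -
      have "?c m powr q \<le> A"
        using member_le_sum[OF that, of "\<lambda>m. ?c m powr q"] assms(2) A by simp
      then have "(?c m powr q) powr (1 / q) \<le> t"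
        unfolding t_def by (intro le) auto
      then show ?thesis
        using assms(3) by (simp add: powr_powr)
    qed
    have "(\<Sum>m\<in>F. ?c m) \<le> 1 * t"
    proof (rule sum_le_of_sum_powr_le[OF assms(3,4)])
      show "(\<Sum>m\<in>F. ?c m powr q) \<le> 1 * t powr q"
        unfolding t(2) using A by simp
    qed (use c_le t(1) in simp_all)
    then have "op_bound I ?T t"
      by (intro op_bound_mono[OF op_bound_sum_rank_one]) simp
    then have "singular_value I ?T 0 \<le> t"
      by (intro singular_value_le[OF assms(1) rank_le_zero[OF assms(1), of "\<lambda>_ _. 0"]])
         (simp_all add: less_imp_le[OF t(1)])
    moreover have "t \<le> (6 * A / (real j + 1)) powr (1 / q)"
      unfolding t_def using True assms(5) by (intro le) (auto simp: le_divide_eq)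
    ultimately show ?thesis
      using singular_value_antimono[OF assms(1), of 0 j ?T] by linarith
  next
    case False
    define r where "r = j div 3"
    have r: "1 \<le> r" "3 * r \<le> j" "j + 1 \<le> 6 * r"
      using False unfolding r_def by presburger+
    define t where "t = (A / r) powr (1 / q)"
    have t: "0 < t" "t powr q = A / r"
      using assms(5) r(1) powr_q by (simp_all add: t_def)
    define F1 where "F1 = {m\<in>F. t < ?c m}"
    define F2 where "F2 = {m\<in>F. ?c m \<le> t}"
    have F: "F = F1 \<union> F2" "F1 \<inter> F2 = {}" "finite F1" "finite F2"
      using assms(2) by (auto simp: F1_def F2_def)
    have "card F1 * (A / r) = (\<Sum>m\<in>F1. t powr q)"
      by (simp add: t)
    also have "\<dots> \<le> (\<Sum>m\<in>F1. ?c m powr q)"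
      using assms(3) t(1) by (intro sum_mono powr_mono2) (auto simp: F1_def)
    also have "\<dots> \<le> (\<Sum>m\<in>F. ?c m powr q)"
      using assms(2) by (intro sum_mono2) (auto simp: F1_def)
    also have "\<dots> \<le> A" by (rule A)
    finally have card: "card F1 \<le> r"
      using assms(5) r(1) by (simp add: field_simps)
    have "(\<Sum>m\<in>F2. ?c m powr q) \<le> (\<Sum>m\<in>F. ?c m powr q)"
      using assms(2) by (intro sum_mono2) (auto simp: F2_def)
    also have "\<dots> \<le> r * t powr q"
      using A r(1) t(2) by simp
    finally have F2_powr: "(\<Sum>m\<in>F2. ?c m powr q) \<le> r * t powr q" .
    have "(\<Sum>m\<in>F2. ?c m) \<le> r * t"
      by (rule sum_le_of_sum_powr_le[OF assms(3,4) _ _ t(1) F2_powr]) (simp_all add: F2_def)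
    from low_rank_approximation[OF assms(1) less_imp_le[OF t(1)] this]
    obtain K where K: "rank_le I K (2 * r)"
        "op_bound I (\<lambda>i j. (\<Sum>m\<in>F2. u m i * v m j) - K i j) t"
      by blast
    have "rank_le I (\<lambda>i k. (\<Sum>m\<in>F1. u m i * v m k) + K i k) (card F1 + 2 * r)"
      using assms(1) F K by (intro rank_le_add rank_le_sum)
    then have rank: "rank_le I (\<lambda>i k. (\<Sum>m\<in>F1. u m i * v m k) + K i k) j"
      by (rule rank_le_mono[OF assms(1)]) (use card r in linarith)
    have eq: "?T i k - ((\<Sum>m\<in>F1. u m i * v m k) + K i k) = (\<Sum>m\<in>F2. u m i * v m k) - K i k" for i k
      using F by (simp add: sum.union_disjoint)
    have "op_bound I (\<lambda>i k. ?T i k - ((\<Sum>m\<in>F1. u m i * v m k) + K i k)) t"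
      unfolding eq by (rule K(2))
    then have "singular_value I ?T j \<le> t"
      by (rule singular_value_le[OF assms(1) rank _ less_imp_le[OF t(1)]])
    also have "t \<le> (6 * A / (real j + 1)) powr (1 / q)"
    proof -
      have "real j + 1 \<le> 6 * real r"
        using r(3) by linarith
      then have "A * (real j + 1) \<le> A * (6 * real r)"
        using assms(5) by (intro mult_left_mono) auto
      then have "A / real r \<le> 6 * A / (real j + 1)"
        using r(1) by (simp add: field_simps)
      then show ?thesis
        unfolding t_def using assms(5) by (intro le) simp_all
    qed
    finally show ?thesis .
  qed
qed

text \<open>\<open>A\<close> bounds the cost of some decomposition of \<open>T\<close> into rank one
  matrices. Costs are not raised to the power \<open>1 / q\<close>, so they simply add up when
  decompositions are concatenated; lists make concatenation immediate.\<close>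

definition atomic :: "'i set \<Rightarrow> real \<Rightarrow> 'i cmatrix \<Rightarrow> real \<Rightarrow> bool" where
  "atomic I q T A \<longleftrightarrow> (\<exists>L. (\<forall>i\<in>I. \<forall>k\<in>I. T i k = (\<Sum>(u, v)\<leftarrow>L. u i * v k)) \<and>
     (\<Sum>(u, v)\<leftarrow>L. (l2 I u * l2 I v) powr q) \<le> A)"

lemma atomic_zero:
  assumes "\<And>i k. i \<in> I \<Longrightarrow> k \<in> I \<Longrightarrow> T i k = 0" "0 \<le> A"
  shows "atomic I q T A"
  unfolding atomic_def using assms by (intro exI[of _ "[]"]) simp

lemma atomic_rank_one: "atomic I q (\<lambda>i k. u i * v k) ((l2 I u * l2 I v) powr q)"
  unfolding atomic_def by (intro exI[of _ "[(u, v)]"]) simp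

lemma atomic_add:
  assumes "atomic I q S A" "atomic I q T B"
  shows "atomic I q (\<lambda>i k. S i k + T i k) (A + B)"
proof -
  obtain L where L: "\<forall>i\<in>I. \<forall>k\<in>I. S i k = (\<Sum>(u, v)\<leftarrow>L. u i * v k)"
      "(\<Sum>(u, v)\<leftarrow>L. (l2 I u * l2 I v) powr q) \<le> A"
    using assms(1) unfolding atomic_def by blast
  obtain M where M: "\<forall>i\<in>I. \<forall>k\<in>I. T i k = (\<Sum>(u, v)\<leftarrow>M. u i * v k)"
      "(\<Sum>(u, v)\<leftarrow>M. (l2 I u * l2 I v) powr q) \<le> B"
    using assms(2) unfolding atomic_def by blast
  show ?thesis
    unfolding atomic_def using L M by (intro exI[of _ "L @ M"]) simp
qed

lemma atomic_mono: "atomic I q T A \<Longrightarrow> A \<le> B \<Longrightarrow> atomic I q T B"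
  unfolding atomic_def by (meson order_trans)

lemma atomic_cong:
  assumes "atomic I q S A" "\<And>i k. i \<in> I \<Longrightarrow> k \<in> I \<Longrightarrow> S i k = T i k"
  shows "atomic I q T A"
  using assms unfolding atomic_def by simp

lemma singular_value_atomic_le:
  assumes "finite I" "0 < q" "q < 1" "0 < A" "atomic I q T A"
  shows "singular_value I T j \<le> (6 * A / (real j + 1)) powr (1 / q)"
proof -
  obtain L where L: "\<And>i k. i \<in> I \<Longrightarrow> k \<in> I \<Longrightarrow> T i k = (\<Sum>(u, v)\<leftarrow>L. u i * v k)"
      "(\<Sum>(u, v)\<leftarrow>L. (l2 I u * l2 I v) powr q) \<le> A"
    using assms(5) unfolding atomic_def by blast
  define u where "u m = fst (L ! m)" for m
  define v where "v m = snd (L ! m)" for m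
  have sum: "(\<Sum>(u, v)\<leftarrow>L. f u v) = (\<Sum>m<length L. f (u m) (v m))"
    for f :: "_ \<Rightarrow> _ \<Rightarrow> 'b :: comm_monoid_add"
    by (simp add: sum_list_sum_nth atLeast0LessThan u_def v_def case_prod_beta)
  have "singular_value I (\<lambda>i k. \<Sum>m<length L. u m i * v m k) j \<le> (6 * A / (real j + 1)) powr (1 / q)"
    using assms L(2) unfolding sum by (intro singular_value_sum_rank_one_le) auto
  also have "singular_value I (\<lambda>i k. \<Sum>m<length L. u m i * v m k) = singular_value I T"
    by (rule singular_value_cong[OF assms(1)]) (simp add: L(1) sum)
  finally show ?thesis .
qed

text \<open>With \<open>e\<close> the normalised last spanning vector, \<open>D\<close> is the sum
  of its projection onto \<open>e\<close>, a rank one matrix, and its projection onto the orthogonal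
  complement, whose range is spanned by \<open>r\<close> vectors. Neither projection exceeds the
  norm bound \<open>M\<close>, so induction gives one term of size at most \<open>M\<close> for each
  unit of rank.\<close>

lemma atomic_rank_le:
  assumes "finite I" "rank_le I D r" "op_bound I D M" "0 \<le> M" "0 < q"
  shows "atomic I q D (real r * M powr q)"
  using assms(2,3)
proof (induction r arbitrary: D)
  case 0
  have "D i k = 0" if "i \<in> I" "k \<in> I" for i k
  proof -
    have "D i k = (\<Sum>l\<in>I. if l = k then D i l else 0)"
      using that(2) assms(1) by simp
    also have "\<dots> = app I D (\<lambda>l. if l = k then 1 else 0) i"
      by (rule sum.cong) simp_all
    also have "\<dots> = 0"
      using 0(1) that(1) unfolding rank_le_finite_iff[OF assms(1)] by simp
    finally show ?thesis .
  qed
  then show ?case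
    by (intro atomic_zero) simp_all
next
  case (Suc r)
  obtain u where u: "\<And>x. \<exists>c :: nat \<Rightarrow> _. \<forall>i\<in>I. app I D x i = (\<Sum>m<Suc r. c m * u m i)"
    using Suc.prems(1) unfolding rank_le_finite_iff[OF assms(1)] by blast
  show ?case
  proof (cases "l2 I (u r) = 0")
    case True
    then have "u r i = 0" if "i \<in> I" for i
      using that assms(1) by (simp add: L2_set_eq_0_iff)
    then have "\<exists>c :: nat \<Rightarrow> _. \<forall>i\<in>I. app I D x i = (\<Sum>m<r. c m * u m i)" for x
      using u[of x] by simp
    then have "rank_le I D r"
      unfolding rank_le_finite_iff[OF assms(1)] by blast
    from Suc.IH[OF this Suc.prems(2)] show ?thesis
      by (rule atomic_mono) (simp add: mult_right_mono)
  next
    case False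
    then have pos: "0 < l2 I (u r)" by (simp add: less_le)
    define e where "e = (\<lambda>i. complex_of_real (1 / l2 I (u r)) * u r i)"
    have e1: "l2 I e = 1"
      unfolding e_def l2_mult norm_of_real using pos by simp
    have ur: "u r i = complex_of_real (l2 I (u r)) * e i" for i
      using pos by (simp add: e_def)
    \<comment> \<open>\<open>P\<close> projects onto the orthogonal complement of \<open>e\<close>;
      it kills \<open>u r\<close>.\<close>
    define P where "P = (\<lambda>y i. y i - (\<Sum>l\<in>I. y l * cnj (e l)) * e i)"
    have P_ur: "P (u r) i = 0" for i
    proof -
      have ee: "(\<Sum>l\<in>I. e l * cnj (e l)) = 1"
        using arg_cong[OF l2_power2[of e I], of complex_of_real] unfolding e1 of_real_sum complex_norm_square
        by simp
      have "(\<Sum>l\<in>I. u r l * cnj (e l)) = (\<Sum>l\<in>I. complex_of_real (l2 I (u r)) * (e l * cnj (e l)))"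
        by (intro sum.cong refl) (simp add: e_def pos)
      also have "\<dots> = complex_of_real (l2 I (u r))"
        unfolding sum_distrib_left[symmetric] ee by simp
      finally show ?thesis
        using ur[of i] by (simp add: P_def)
    qed
    define b where "b = (\<lambda>k. \<Sum>l\<in>I. cnj (e l) * D l k)"
    define D' where "D' = (\<lambda>i k. D i k - e i * b k)"
    have D'_app: "app I D' x i = P (app I D x) i" for x i
    proof -
      have "(\<Sum>k\<in>I. b k * x k) = (\<Sum>k\<in>I. \<Sum>l\<in>I. D l k * x k * cnj (e l))"
        unfolding b_def sum_distrib_right by (intro sum.cong refl) simp
      also have "\<dots> = (\<Sum>l\<in>I. app I D x l * cnj (e l))"
        unfolding sum_distrib_right by (rule sum.swap)
      finally have bx: "(\<Sum>k\<in>I. b k * x k) = (\<Sum>l\<in>I. app I D x l * cnj (e l))" .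
      have "(\<Sum>k\<in>I. e i * b k * x k) = (\<Sum>k\<in>I. b k * x k) * e i"
        unfolding sum_distrib_right by (intro sum.cong refl) simp
      then have "(\<Sum>k\<in>I. e i * b k * x k) = (\<Sum>l\<in>I. app I D x l * cnj (e l)) * e i"
        unfolding bx .
      then show ?thesis
        by (simp add: D'_def P_def left_diff_distrib sum_subtractf)
    qed
    have "rank_le I D' r"
      unfolding rank_le_finite_iff[OF assms(1)]
    proof (rule exI, rule allI)
      fix x
      obtain c where c: "\<forall>i\<in>I. app I D x i = (\<Sum>m<Suc r. c m * u m i)"
        using u by blast
      have "app I D' x i = (\<Sum>m<r. c m * P (u m) i)" if "i \<in> I" for i
      proof -
        have "(\<Sum>l\<in>I. app I D x l * cnj (e l)) = (\<Sum>l\<in>I. \<Sum>m<Suc r. c m * (u m l * cnj (e l)))"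
          using c by (intro sum.cong refl) (simp add: sum_distrib_right mult.assoc distrib_right)
        also have "\<dots> = (\<Sum>m<Suc r. c m * (\<Sum>l\<in>I. u m l * cnj (e l)))"
          unfolding sum_distrib_left by (rule sum.swap)
        finally have "app I D' x i = (\<Sum>m<Suc r. c m * P (u m) i)"
          using c that unfolding D'_app unfolding P_def
          by (simp add: right_diff_distrib sum_subtractf sum_distrib_right mult.assoc distrib_right)
        then show ?thesis
          by (simp add: P_ur)
      qed
      then show "\<exists>c. \<forall>i\<in>I. app I D' x i = (\<Sum>m<r. c m * P (u m) i)"
        by blast
    qed
    moreover have "op_bound I D' M"
      unfolding op_bound_def
    proof
      fix x
      have "(l2 I (app I D' x))\<^sup>2 = (l2 I (P (app I D x)))\<^sup>2"
        unfolding D'_app ..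
      also have "\<dots> \<le> (l2 I (app I D x))\<^sup>2"
        unfolding P_def l2_project(1)[OF e1] by simp
      finally have "l2 I (app I D' x) \<le> l2 I (app I D x)"
        by (rule power2_le_imp_le) simp
      also have "\<dots> \<le> M * l2 I x"
        using Suc.prems(2) unfolding op_bound_def by blast
      finally show "l2 I (app I D' x) \<le> M * l2 I x" .
    qed
    ultimately have D': "atomic I q D' (real r * M powr q)"
      by (rule Suc.IH)
    \<comment> \<open>The squared norm of \<open>b\<close> is the pairing of the conjugate of
      \<open>e\<close> with \<open>D\<close> applied to the conjugate of \<open>b\<close>, hence at
      most \<open>M\<close> times the norm of \<open>b\<close>.\<close>
    have b: "l2 I b \<le> M"
    proof -
      have "complex_of_real ((l2 I b)\<^sup>2) = (\<Sum>k\<in>I. b k * cnj (b k))"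
        unfolding l2_power2 of_real_sum complex_norm_square ..
      also have "\<dots> = (\<Sum>k\<in>I. \<Sum>l\<in>I. cnj (e l) * (D l k * cnj (b k)))"
        by (intro sum.cong refl) (simp add: b_def sum_distrib_right mult.assoc)
      also have "\<dots> = (\<Sum>l\<in>I. cnj (e l) * app I D (\<lambda>k. cnj (b k)) l)"
        unfolding sum_distrib_left by (rule sum.swap)
      finally have "(l2 I b)\<^sup>2 = cmod (\<Sum>l\<in>I. cnj (e l) * app I D (\<lambda>k. cnj (b k)) l)"
        using norm_of_real[of "(l2 I b)\<^sup>2", where 'a = complex] by simp
      also have "\<dots> \<le> l2 I (\<lambda>l. cnj (e l)) * l2 I (app I D (\<lambda>k. cnj (b k)))"
        by (rule cmod_sum_mult_le)
      also have "\<dots> \<le> l2 I (\<lambda>l. cnj (e l)) * (M * l2 I (\<lambda>k. cnj (b k)))"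
        by (intro mult_left_mono Suc.prems(2)[unfolded op_bound_def, rule_format]) simp
      also have "\<dots> = M * l2 I b"
        using e1 by simp
      finally show ?thesis
        by (cases "l2 I b = 0") (use assms(4) in \<open>auto simp: power2_eq_square less_le\<close>)
    qed
    have "(l2 I e * l2 I b) powr q \<le> M powr q"
      using b e1 assms(5) by (intro powr_mono2) auto
    with atomic_add[OF atomic_rank_one[of I q e b] D']
    have "atomic I q (\<lambda>i k. e i * b k + D' i k) (real (Suc r) * M powr q)"
      by (elim atomic_mono) (simp add: distrib_right)
    then show ?thesis
      by (rule atomic_cong) (simp add: D'_def)
  qed
qed

text \<open>Dyadic telescoping: \<open>K l\<close> has rank below \<open>2^l\<close> and error at
  most \<open>2 * \<rho>^l\<close>, so \<open>K (Suc l) - K l\<close> has rank at most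
  \<open>3 * 2^l\<close> and norm at most \<open>4 * \<rho>^l\<close>. Its cost is at most
  \<open>3 * 4 powr q * \<theta>^l\<close>, and \<open>p < q\<close> makes the ratio
  \<open>\<theta>\<close> smaller than \<open>1\<close>.\<close>

lemma atomic_of_singular_values_le:
  assumes "finite I" "0 < p" "p < q"
    and s: "\<And>j. singular_value I B j \<le> (real j + 1) powr - (1 / p)"
  shows "atomic I q B (3 * 4 powr q / (1 - 2 powr (1 - q / p)))"
proof -
  define \<rho> :: real where "\<rho> = 2 powr - (1 / p)"
  define \<theta> where "\<theta> = 2 * \<rho> powr q"
  have \<rho>: "0 < \<rho>" "\<rho> \<le> 1"
    unfolding \<rho>_def using assms(2) by (auto intro: powr_le_one_le simp: powr_minus_divide ge_one_powr_ge_zero)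
  have \<theta>: "\<theta> = 2 powr (1 - q / p)"
    using powr_add[of 2 1 "- (q / p)"] by (simp add: \<theta>_def \<rho>_def powr_powr)
  have "\<theta> < 2 powr 0"
    unfolding \<theta> using assms(2,3) by (intro powr_less_mono) (auto simp: less_divide_eq)
  then have \<theta>01: "0 \<le> \<theta>" "\<theta> < 1"
    by (simp_all add: \<theta>_def)
  \<comment> \<open>The index \<open>2^l - 1\<close> turns the assumed bound into exactly
    \<open>\<rho>^l\<close>. For \<open>l = 0\<close> the rank is \<open>0\<close>, so the
    telescoping starts from a matrix that vanishes on \<open>I\<close>.\<close>
  have "\<exists>K. rank_le I K (2 ^ l - 1) \<and> op_bound I (\<lambda>i k. B i k - K i k) (2 * \<rho> ^ l)" for l
  proof -
    have "singular_value I B (2 ^ l - 1) \<le> (2 ^ l) powr - (1 / p)"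
      using s[of "2 ^ l - 1"] by (simp add: of_nat_diff)
    also have "\<dots> = \<rho> ^ l"
      by (simp add: \<rho>_def powr_powr mult.commute flip: powr_realpow)
    also have "\<dots> < 2 * \<rho> ^ l"
      using \<rho>(1) by simp
    finally show ?thesis
      using singular_value_approx[OF assms(1)] by blast
  qed
  then obtain K where K: "\<And>l. rank_le I (K l) (2 ^ l - 1)"
      "\<And>l. op_bound I (\<lambda>i k. B i k - K l i k) (2 * \<rho> ^ l)"
    by metis
  define a where "a = (\<lambda>l. real (3 * 2 ^ l) * (4 * \<rho> ^ l) powr q)"
  have a: "a l = 3 * 4 powr q * \<theta> ^ l" for l
  proof -
    have "(\<rho> ^ l) powr q = (\<rho> powr q) ^ l"
      using \<rho>(1) by (simp add: powr_powr mult.commute flip: powr_realpow)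
    then show ?thesis
      by (simp add: a_def \<theta>_def powr_mult power_mult_distrib)
  qed
  have piece: "atomic I q D (a l)"
    if "rank_le I D r" "r \<le> 3 * 2 ^ l" "op_bound I D s" "s \<le> 4 * \<rho> ^ l" for D r s l
    unfolding a_def
  proof (rule atomic_rank_le[OF assms(1)])
    show "rank_le I D (3 * 2 ^ l)" by (rule rank_le_mono[OF assms(1) that(1,2)])
    show "op_bound I D (4 * \<rho> ^ l)" by (rule op_bound_mono[OF that(3,4)])
  qed (use \<rho>(1) assms in auto)
  have "atomic I q (K L) (\<Sum>l<L. a l)" for L
  proof (induction L)
    case 0
    have "rank_le I (K 0) 0" using K(1)[of 0] by simp
    from atomic_rank_le[OF assms(1) this op_bound_exists[OF assms(1)]] assms
    show ?case by (simp add: sum_nonneg)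
  next
    case (Suc L)
    have "rank_le I (\<lambda>i k. K (Suc L) i k + - K L i k) (2 ^ Suc L - 1 + (2 ^ L - 1))"
      by (intro rank_le_add rank_le_uminus assms(1) K(1))
    moreover have "op_bound I (\<lambda>i k. (B i k - K L i k) + - (B i k - K (Suc L) i k)) (2 * \<rho> ^ L + 2 * \<rho> ^ Suc L)"
      by (intro op_bound_add op_bound_uminus K(2))
    then have "op_bound I (\<lambda>i k. K (Suc L) i k + - K L i k) (2 * \<rho> ^ L + 2 * \<rho> ^ Suc L)"
      by (rule op_bound_cong) simp
    moreover have "2 * \<rho> ^ L + 2 * \<rho> ^ Suc L \<le> 4 * \<rho> ^ L"
      using \<rho> by (simp add: mult_left_le_one_le)
    ultimately have "atomic I q (\<lambda>i k. K (Suc L) i k + - K L i k) (a L)"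
      by (intro piece) auto
    then have "atomic I q (K (Suc L)) ((\<Sum>l<L. a l) + a L)"
      by (rule atomic_cong[OF atomic_add[OF Suc.IH]]) simp
    then show ?case by simp
  qed
  note K_atomic = this
  \<comment> \<open>Once \<open>2^L\<close> reaches \<open>card I\<close>, the remainder
    \<open>B - K L\<close> satisfies the rank bound of a piece trivially and serves as the last
    one.\<close>
  obtain L where L: "card I \<le> 2 ^ L"
    using less_imp_le[OF less_exp] by blast
  have "atomic I q (\<lambda>i k. B i k - K L i k) (a L)"
    using L \<rho>(1) by (intro piece[OF rank_le_card[OF assms(1)] _ K(2)[of L]]) auto
  then have "atomic I q B ((\<Sum>l<L. a l) + a L)"
    by (rule atomic_cong[OF atomic_add[OF K_atomic]]) simp
  then have "atomic I q B (\<Sum>l<Suc L. a l)"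
    by simp
  moreover have "(\<Sum>l<Suc L. a l) \<le> 3 * 4 powr q / (1 - \<theta>)"
  proof -
    have "(\<Sum>l<Suc L. \<theta> ^ l) \<le> 1 / (1 - \<theta>)"
      using \<theta>01 by (simp only: sum_gp_strict) (simp add: divide_right_mono)
    then have "3 * 4 powr q * (\<Sum>l<Suc L. \<theta> ^ l) \<le> 3 * 4 powr q * (1 / (1 - \<theta>))"
      by (intro mult_left_mono) auto
    then show ?thesis
      unfolding a sum_distrib_left[symmetric] by simp
  qed
  ultimately show ?thesis
    unfolding \<theta> by (rule atomic_mono)
qed

subsection \<open>Triangular truncation\<close>

text \<open>The concave power function lies below its tangent at \<open>1\<close>.\<close>

lemma powr_le_affine:
  fixes a q :: real
  assumes "0 \<le> a" "0 < q" "q < 1"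
  shows "a powr q \<le> q * a + (1 - q)"
  using Youngs_inequality_0[of q "1 - q" a 1] assms by (cases "a = 0") auto

text \<open>This is midpoint concavity: both numbers are divided by their mean \<open>h\<close>, and
  the tangent bounds add up to \<open>2\<close>.\<close>

lemma powr_add_le:
  fixes x y q :: real
  assumes "0 \<le> x" "0 \<le> y" "0 < q" "q < 1"
  shows "x powr q + y powr q \<le> 2 powr (1 - q) * (x + y) powr q"
proof (cases "x + y = 0")
  case True
  with assms show ?thesis by (simp add: add_nonneg_eq_0_iff)
next
  case False
  define h where "h = (x + y) / 2"
  have h: "0 < h" using False assms by (simp add: h_def)
  have "(x / h) powr q + (y / h) powr q \<le> (q * (x / h) + (1 - q)) + (q * (y / h) + (1 - q))"
    using h assms by (intro add_mono powr_le_affine) auto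
  also have "\<dots> = q * ((x + y) / h) + 2 - 2 * q"
    by (simp add: add_divide_distrib algebra_simps)
  also have "(x + y) / h = 2"
    using False by (simp add: h_def divide_eq_eq)
  also have "q * 2 + 2 - 2 * q = 2"
    by simp
  finally have "x powr q + y powr q \<le> 2 * h powr q"
    using h assms by (simp add: powr_divide add_divide_distrib[symmetric] divide_le_eq)
  also have "\<dots> = 2 powr (1 - q) * (x + y) powr q"
    using assms by (simp add: h_def powr_divide powr_diff)
  finally show ?thesis .
qed

text \<open>
  Halving an interval of length \<open>2\<^bsup>k+1\<^esup>\<close> leaves two triangular truncations of half the size and one
  rank one block, so the constants satisfy \<open>b\<^bsub>k+1\<^esub> = 2\<^bsup>1-q\<^esup> b\<^sub>k + 1\<close>; for \<open>q < 1\<close> the sum of the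
  geometric progression has the order of its last term.
\<close>

lemma atomic_chi_rank_one:
  assumes "finite I" "0 < q" "q < 1"
    and "\<And>i. i \<notin> {a..<a + 2 ^ k} \<Longrightarrow> u i = 0" "\<And>i. i \<notin> {a..<a + 2 ^ k} \<Longrightarrow> v i = 0"
  shows "atomic I q (chi \<star> (\<lambda>i k. u i * v k))
    (((2 powr (1 - q)) ^ Suc k - 1) / (2 powr (1 - q) - 1) * (l2 I u * l2 I v) powr q)"
  using assms(4,5)
proof (induction k arbitrary: a u v)
  have \<beta>: "2 powr (1 - q) > 1"
    using assms(3) by simp
  {
    case 0
    have "(chi \<star> (\<lambda>i k. u i * v k)) i k = u i * v k" for i k
      using 0(1)[of i] 0(2)[of k] by (cases "i = a"; cases "k = a") (auto simp: schur_prod_def chi_def)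
    then have "chi \<star> (\<lambda>i k. u i * v k) = (\<lambda>i k. u i * v k)"
      by (intro ext)
    then show ?case
      using atomic_rank_one[of I q u v] assms(3) by simp
  next
    case (Suc k)
    define b where "b = ((2 powr (1 - q)) ^ Suc k - 1) / (2 powr (1 - q) - 1)"
    have b0: "0 \<le> b"
      unfolding b_def using \<beta> by (intro divide_nonneg_nonneg) (simp_all add: one_le_power del: power_Suc)
    \<comment> \<open>The quotient is the closed form of a finite geometric sum with ratio
      \<open>2 powr (1 - q)\<close>, so one more term means multiplying by the ratio and adding
      \<open>1\<close>.\<close>
    have b: "((2 powr (1 - q)) ^ Suc (Suc k) - 1) / (2 powr (1 - q) - 1) = 2 powr (1 - q) * b + 1"
      using assms(3) unfolding b_def by (simp add: divide_simps) (simp add: algebra_simps)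
    define c where "c = a + 2 ^ k"
    define u1 where "u1 = (\<lambda>i. if i < c then u i else 0)"
    define u2 where "u2 = (\<lambda>i. if i < c then 0 else u i)"
    define v1 where "v1 = (\<lambda>i. if i < c then v i else 0)"
    define v2 where "v2 = (\<lambda>i. if i < c then 0 else v i)"
    have "atomic I q (chi \<star> (\<lambda>i k. u1 i * v1 k)) (b * (l2 I u1 * l2 I v1) powr q)"
      unfolding b_def by (rule Suc.IH[of a]) (use Suc.prems in \<open>auto simp: u1_def v1_def c_def\<close>)
    moreover have "atomic I q (chi \<star> (\<lambda>i k. u2 i * v2 k)) (b * (l2 I u2 * l2 I v2) powr q)"
      unfolding b_def by (rule Suc.IH[of c]) (use Suc.prems in \<open>auto simp: u2_def v2_def c_def\<close>)
    ultimately have "atomic I q (\<lambda>i k. (chi \<star> (\<lambda>i k. u1 i * v1 k)) i k + (chi \<star> (\<lambda>i k. u2 i * v2 k)) i k + u1 i * v2 k)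
        (b * (l2 I u1 * l2 I v1) powr q + b * (l2 I u2 * l2 I v2) powr q + (l2 I u1 * l2 I v2) powr q)"
      by (intro atomic_add atomic_rank_one)
    \<comment> \<open>The block of \<open>u1\<close> and \<open>v2\<close> lies entirely above the
      diagonal and is kept whole; the block of \<open>u2\<close> and \<open>v1\<close> lies strictly
      below and disappears.\<close>
    moreover have "(\<lambda>i k. (chi \<star> (\<lambda>i k. u1 i * v1 k)) i k + (chi \<star> (\<lambda>i k. u2 i * v2 k)) i k + u1 i * v2 k)
        = chi \<star> (\<lambda>i k. u i * v k)"
      by (auto simp: fun_eq_iff schur_prod_def chi_def u1_def u2_def v1_def v2_def)
    moreover have "b * (l2 I u1 * l2 I v1) powr q + b * (l2 I u2 * l2 I v2) powr q + (l2 I u1 * l2 I v2) powr q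
        \<le> (2 powr (1 - q) * b + 1) * (l2 I u * l2 I v) powr q"
    proof -
      have split: "(l2 I u)\<^sup>2 = (l2 I u1)\<^sup>2 + (l2 I u2)\<^sup>2" "(l2 I v)\<^sup>2 = (l2 I v1)\<^sup>2 + (l2 I v2)\<^sup>2"
        unfolding l2_power2 sum.distrib[symmetric]
        by (auto simp: u1_def u2_def v1_def v2_def intro!: sum.cong)
      have le: "l2 I u1 \<le> l2 I u" "l2 I v2 \<le> l2 I v"
        using split by (auto intro: power2_le_imp_le)
      \<comment> \<open>Cauchy-Schwarz in the plane, for the pairs of norms of the two halves of
        \<open>u\<close> and \<open>v\<close>.\<close>
      have "l2 I u1 * l2 I v1 + l2 I u2 * l2 I v2 \<le> l2 I u * l2 I v"
      proof (rule power2_le_imp_le)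
        have "(l2 I u * l2 I v)\<^sup>2 = ((l2 I u1)\<^sup>2 + (l2 I u2)\<^sup>2) * ((l2 I v1)\<^sup>2 + (l2 I v2)\<^sup>2)"
          by (simp add: power_mult_distrib split)
        also have "\<dots> = (l2 I u1 * l2 I v1 + l2 I u2 * l2 I v2)\<^sup>2 + (l2 I u1 * l2 I v2 - l2 I u2 * l2 I v1)\<^sup>2"
          by (simp add: power2_eq_square algebra_simps)
        finally show "(l2 I u1 * l2 I v1 + l2 I u2 * l2 I v2)\<^sup>2 \<le> (l2 I u * l2 I v)\<^sup>2"
          by simp
      qed simp
      then have "(l2 I u1 * l2 I v1 + l2 I u2 * l2 I v2) powr q \<le> (l2 I u * l2 I v) powr q"
        using assms(2) by (intro powr_mono2) auto
      then have "2 powr (1 - q) * (l2 I u1 * l2 I v1 + l2 I u2 * l2 I v2) powr q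
          \<le> 2 powr (1 - q) * (l2 I u * l2 I v) powr q"
        by (rule mult_left_mono) simp
      moreover have "(l2 I u1 * l2 I v1) powr q + (l2 I u2 * l2 I v2) powr q
          \<le> 2 powr (1 - q) * (l2 I u1 * l2 I v1 + l2 I u2 * l2 I v2) powr q"
        by (intro powr_add_le assms(2,3) mult_nonneg_nonneg L2_set_nonneg)
      ultimately have "(l2 I u1 * l2 I v1) powr q + (l2 I u2 * l2 I v2) powr q
          \<le> 2 powr (1 - q) * (l2 I u * l2 I v) powr q"
        by linarith
      from mult_left_mono[OF this b0]
      have "b * (l2 I u1 * l2 I v1) powr q + b * (l2 I u2 * l2 I v2) powr q
          \<le> 2 powr (1 - q) * b * (l2 I u * l2 I v) powr q"
        by (simp add: distrib_left mult_ac)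
      moreover have "(l2 I u1 * l2 I v2) powr q \<le> (l2 I u * l2 I v) powr q"
        using le assms(2) by (intro powr_mono2 mult_mono) auto
      ultimately show ?thesis
        by (simp add: distrib_right)
    qed
    ultimately show ?case
      unfolding b by (simp only: atomic_mono)
  }
qed

text \<open>Each rank one term is handled on an interval of dyadic length \<open>2^k\<close>
  containing \<open>{1..n}\<close>. The least such length is at most \<open>2 * n\<close>, so
  \<open>(2 powr (1 - q)) ^ Suc k\<close> is at most \<open>(4 * n) powr (1 - q)\<close>. The bound
  passes to \<open>B\<close> because costs add up.\<close>

lemma atomic_chi:
  assumes "0 < q" "q < 1" "1 \<le> n" "atomic {1..n} q B A"
  shows "atomic {1..n} q (chi \<star> B)
    (4 powr (1 - q) / (2 powr (1 - q) - 1) * real n powr (1 - q) * A)"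
proof -
  let ?I = "{1..n}" and ?\<beta> = "2 powr (1 - q) :: real"
  define D where "D = 4 powr (1 - q) / (?\<beta> - 1) * real n powr (1 - q)"
  have \<beta>: "?\<beta> > 1"
    using assms(2) by simp
  then have D0: "0 \<le> D"
    by (simp add: D_def)
  define k where "k = (LEAST k. n \<le> 2 ^ k)"
  have k: "n \<le> 2 ^ k"
    unfolding k_def by (rule LeastI_ex) (use less_imp_le[OF less_exp] in blast)
  have k': "2 ^ k \<le> 2 * n"
  proof (cases k)
    case (Suc m)
    then have "\<not> n \<le> 2 ^ m"
      using not_less_Least[of m "\<lambda>k. n \<le> 2 ^ k"] by (simp add: k_def)
    then show ?thesis
      by (simp add: Suc)
  qed (use assms in simp)
  have "?\<beta> ^ Suc k = ?\<beta> * (2 ^ k) powr (1 - q)"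
    by (simp add: powr_powr powr_power mult.commute flip: powr_realpow)
  also have "\<dots> \<le> ?\<beta> * (2 * real n) powr (1 - q)"
    using k' assms(2) of_nat_mono[OF k', where 'a = real] by (intro mult_left_mono powr_mono2) auto
  also have "\<dots> = 4 powr (1 - q) * real n powr (1 - q)"
    by (simp add: powr_mult flip: powr_add powr_mult mult.assoc)
  finally have D: "(?\<beta> ^ Suc k - 1) / (?\<beta> - 1) \<le> D"
    unfolding D_def using \<beta> by (simp add: divide_right_mono)
  have one: "atomic ?I q (chi \<star> (\<lambda>i k. u i * v k)) (D * (l2 ?I u * l2 ?I v) powr q)" for u v
  proof -
    \<comment> \<open>The truncation lemma asks for vectors vanishing off the dyadic interval.
      Cutting them off outside \<open>{1..n}\<close> changes neither the norms nor the entries that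
      \<open>atomic\<close> looks at.\<close>
    define u' where "u' = (\<lambda>i. if i \<in> ?I then u i else 0)"
    define v' where "v' = (\<lambda>i. if i \<in> ?I then v i else 0)"
    have "atomic ?I q (chi \<star> (\<lambda>i k. u' i * v' k))
        ((?\<beta> ^ Suc k - 1) / (?\<beta> - 1) * (l2 ?I u' * l2 ?I v') powr q)"
      using k by (intro atomic_chi_rank_one[of _ _ 1]) (use assms in \<open>auto simp: u'_def v'_def\<close>)
    then have "atomic ?I q (chi \<star> (\<lambda>i k. u' i * v' k)) (D * (l2 ?I u' * l2 ?I v') powr q)"
      by (rule atomic_mono) (intro mult_right_mono D powr_ge_zero)
    moreover have "l2 ?I u' = l2 ?I u" "l2 ?I v' = l2 ?I v"
      by (auto simp: u'_def v'_def intro!: L2_set_cong)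
    ultimately have "atomic ?I q (chi \<star> (\<lambda>i k. u' i * v' k)) (D * (l2 ?I u * l2 ?I v) powr q)"
      by simp
    then show ?thesis
      by (rule atomic_cong) (simp add: schur_prod_def u'_def v'_def)
  qed
  obtain L where L: "\<And>i k. i \<in> ?I \<Longrightarrow> k \<in> ?I \<Longrightarrow> B i k = (\<Sum>(u, v)\<leftarrow>L. u i * v k)"
      "(\<Sum>(u, v)\<leftarrow>L. (l2 ?I u * l2 ?I v) powr q) \<le> A"
    using assms(4) unfolding atomic_def by blast
  have "atomic ?I q (chi \<star> (\<lambda>i k. \<Sum>(u, v)\<leftarrow>L. u i * v k))
      (D * (\<Sum>(u, v)\<leftarrow>L. (l2 ?I u * l2 ?I v) powr q))" for L
  proof (induction L)
    case Nil
    show ?case by (intro atomic_zero) (simp_all add: schur_prod_def)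
  next
    case (Cons uv L)
    obtain u v where uv: "uv = (u, v)" by (cases uv)
    have "chi \<star> (\<lambda>i k. \<Sum>(u, v)\<leftarrow>uv # L. u i * v k)
        = (\<lambda>i k. (chi \<star> (\<lambda>i k. u i * v k)) i k + (chi \<star> (\<lambda>i k. \<Sum>(u, v)\<leftarrow>L. u i * v k)) i k)"
      by (simp add: schur_prod_def uv distrib_left)
    with atomic_add[OF one[of u v] Cons.IH] show ?case
      by (simp add: uv distrib_left)
  qed
  from this[of L] have "atomic ?I q (chi \<star> (\<lambda>i k. \<Sum>(u, v)\<leftarrow>L. u i * v k)) (D * A)"
    by (rule atomic_mono) (intro mult_left_mono L(2) D0)
  then show ?thesis
    unfolding D_def by (rule atomic_cong) (simp add: schur_prod_def L(1))
qed

subsection \<open>The upper bound\<close>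

text \<open>A discrete form of comparison with the integral of \<open>x powr - \<gamma>\<close>. The
  induction step follows from the tangent bound for the power \<open>1 - \<gamma>\<close> at the
  point \<open>n / (n + 1)\<close>.\<close>

lemma sum_powr_minus_le:
  fixes \<gamma> :: real
  assumes "0 < \<gamma>" "\<gamma> < 1"
  shows "(\<Sum>j<n. (real j + 1) powr - \<gamma>) \<le> real n powr (1 - \<gamma>) / (1 - \<gamma>)"
proof (induction n)
  case (Suc n)
  let ?N = "real n + 1"
  have "(real n / ?N) powr (1 - \<gamma>) \<le> (1 - \<gamma>) * (real n / ?N) + \<gamma>"
    using powr_le_affine[of "real n / ?N" "1 - \<gamma>"] assms by simp
  also have "\<dots> = 1 - (1 - \<gamma>) / ?N"
    by (simp add: field_simps)
  finally have "real n powr (1 - \<gamma>) / ?N powr (1 - \<gamma>) \<le> 1 - (1 - \<gamma>) / ?N"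
    by (simp add: powr_divide)
  then have "real n powr (1 - \<gamma>) \<le> (1 - (1 - \<gamma>) / ?N) * ?N powr (1 - \<gamma>)"
    by (simp add: divide_le_eq)
  also have "\<dots> = ?N powr (1 - \<gamma>) - (1 - \<gamma>) * ?N powr - \<gamma>"
  proof -
    have "?N powr - \<gamma> = ?N powr (1 - \<gamma>) / ?N"
      by (simp add: powr_diff powr_minus_divide)
    then show ?thesis
      by (simp only: left_diff_distrib mult_1 times_divide_eq_left times_divide_eq_right)
  qed
  finally have "(real n powr (1 - \<gamma>) + (1 - \<gamma>) * ?N powr - \<gamma>) / (1 - \<gamma>)
      \<le> ?N powr (1 - \<gamma>) / (1 - \<gamma>)"
    using assms(2) by (intro divide_right_mono) linarith+
  then have "real n powr (1 - \<gamma>) / (1 - \<gamma>) + ?N powr - \<gamma> \<le> ?N powr (1 - \<gamma>) / (1 - \<gamma>)"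
    using assms(2) by (simp only: add_divide_distrib) simp
  with Suc.IH show ?case by (simp add: add.commute)
qed simp

text \<open>Singular values decrease, so \<open>j + 1\<close> copies of the \<open>p\<close>-th
  power of the \<open>j\<close>-th one are dominated by the full sum, which is at most
  \<open>1\<close>.\<close>

lemma singular_value_le_of_schatten_norm_le:
  assumes "finite I" "0 < p" "schatten_norm I p B \<le> 1"
  shows "singular_value I B j \<le> (real j + 1) powr - (1 / p)"
proof (cases "j < card I")
  case True
  let ?s = "singular_value I B" and ?S = "\<Sum>i<card I. singular_value I B i powr p"
  have "?S powr (1 / p) \<le> 1"
    using assms(3) by (simp add: schatten_finite(2)[OF assms(1)])
  then have "(?S powr (1 / p)) powr p \<le> 1"
    using assms(2) by (intro powr_le1) auto
  then have S: "?S \<le> 1"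
    using assms(2) by (simp add: powr_powr sum_nonneg)
  have "(real j + 1) * ?s j powr p = (\<Sum>i<Suc j. ?s j powr p)"
    by simp
  also have "\<dots> \<le> (\<Sum>i<Suc j. ?s i powr p)"
    using assms(2) singular_value_nonneg[OF assms(1)]
    by (intro sum_mono powr_mono2 singular_value_antimono[OF assms(1)]) auto
  also have "\<dots> \<le> ?S"
    using True by (intro sum_mono2) auto
  finally have "?s j powr p \<le> 1 / (real j + 1)"
    using S by (simp add: le_divide_eq mult.commute)
  then have "(?s j powr p) powr (1 / p) \<le> (1 / (real j + 1)) powr (1 / p)"
    using assms(2) by (intro powr_mono2) auto
  then show ?thesis
    using assms(2) singular_value_nonneg[OF assms(1), of B j]
    by (simp add: powr_powr powr_divide powr_minus_divide)
next
  case False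
  then show ?thesis
    using singular_value_eq_0[OF assms(1) rank_le_card[OF assms(1)], of j B] by simp
qed

lemma multiplier_norm_chi_le:
  assumes "0 < p" "p < 1"
  obtains C where "0 < C"
    "\<And>n. 1 \<le> n \<Longrightarrow> multiplier_norm {1..n} p chi \<le> ennreal (C * real n powr (1 / p - 1))"
proof
  \<comment> \<open>The midpoint lies strictly between \<open>p\<close> and \<open>1\<close>:
    \<open>p < q\<close> gives the bounded cost of \<open>B\<close>, and \<open>q < 1\<close> the
    growth under truncation.\<close>
  define q where "q = (1 + p) / 2"
  have q: "0 < q" "q < 1" "p < q"
    using assms by (simp_all add: q_def)
  define \<gamma> where "\<gamma> = p / q"
  have \<gamma>: "0 < \<gamma>" "\<gamma> < 1" "q * \<gamma> = p"
    using assms q by (simp_all add: \<gamma>_def)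
  define C1 where "C1 = 3 * 4 powr q / (1 - 2 powr (1 - q / p))"
  define C2 where "C2 = 4 powr (1 - q) / (2 powr (1 - q) - 1)"
  have "2 powr (1 - q / p) < 2 powr 0"
    using assms q by (intro powr_less_mono) (auto simp: less_divide_eq)
  then have C1: "0 < C1"
    by (simp add: C1_def)
  have "2 powr 0 < 2 powr (1 - q)"
    using q by (intro powr_less_mono) auto
  then have C2: "0 < C2"
    by (simp add: C2_def)
  define C3 where "C3 = (6 * (C2 * C1)) powr \<gamma> / (1 - \<gamma>)"
  have C3: "0 < C3"
    using C1 C2 \<gamma> by (simp add: C3_def)
  show "0 < C3 powr (1 / p)"
    using C3 by simp
  fix n :: nat assume n: "1 \<le> n"
  let ?I = "{1..n}"
  have bound: "schatten_norm ?I p (chi \<star> B) \<le> C3 powr (1 / p) * real n powr (1 / p - 1)"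
    if B: "schatten_norm ?I p B \<le> 1" for B
  proof -
    define A where "A = C2 * real n powr (1 - q) * C1"
    have A: "0 < A"
      using C1 C2 n by (simp add: A_def)
    have "atomic ?I q B C1"
      unfolding C1_def using assms q singular_value_le_of_schatten_norm_le[OF _ assms(1) B]
      by (intro atomic_of_singular_values_le) simp_all
    from atomic_chi[OF q(1,2) n this]
    have "atomic ?I q (chi \<star> B) A"
      by (simp add: A_def C2_def)
    then have s: "singular_value ?I (chi \<star> B) j \<le> (6 * A / (real j + 1)) powr (1 / q)" for j
      using q A by (intro singular_value_atomic_le) simp_all
    have "singular_value ?I (chi \<star> B) j powr p \<le> (6 * A) powr \<gamma> * (real j + 1) powr - \<gamma>" for j
    proof -
      have "singular_value ?I (chi \<star> B) j powr p \<le> ((6 * A / (real j + 1)) powr (1 / q)) powr p"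
        using s assms by (intro powr_mono2 singular_value_nonneg) simp_all
      also have "\<dots> = (6 * A / (real j + 1)) powr \<gamma>"
        by (simp add: powr_powr \<gamma>_def)
      also have "\<dots> = (6 * A) powr \<gamma> * (real j + 1) powr - \<gamma>"
        using A by (simp add: powr_divide powr_minus_divide)
      finally show ?thesis .
    qed
    then have "(\<Sum>j<n. singular_value ?I (chi \<star> B) j powr p)
        \<le> (\<Sum>j<n. (6 * A) powr \<gamma> * (real j + 1) powr - \<gamma>)"
      by (rule sum_mono)
    also have "\<dots> \<le> (6 * A) powr \<gamma> * (real n powr (1 - \<gamma>) / (1 - \<gamma>))"
      unfolding sum_distrib_left[symmetric]
      by (intro mult_left_mono sum_powr_minus_le \<gamma>) simp
    \<comment> \<open>The powers of \<open>n\<close> are collected: the cost contributes the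
      exponent \<open>(1 - q) * \<gamma>\<close> and the sum over \<open>j\<close> contributes
      \<open>1 - \<gamma>\<close>. Since \<open>q * \<gamma> = p\<close>, they add up to
      \<open>1 - p\<close>.\<close>
    also have "(6 * A) powr \<gamma> = (6 * (C2 * C1)) powr \<gamma> * (real n powr (1 - q)) powr \<gamma>"
      by (subst powr_mult[symmetric]) (simp_all add: A_def mult_ac)
    also have "(6 * (C2 * C1)) powr \<gamma> * (real n powr (1 - q)) powr \<gamma> * (real n powr (1 - \<gamma>) / (1 - \<gamma>))
        = C3 * real n powr ((1 - q) * \<gamma> + (1 - \<gamma>))"
      by (simp add: C3_def powr_powr powr_add)
    also have "(1 - q) * \<gamma> + (1 - \<gamma>) = 1 - p"
      using \<gamma>(3) by (simp add: algebra_simps)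
    finally have "(\<Sum>j<n. singular_value ?I (chi \<star> B) j powr p) powr (1 / p)
        \<le> (C3 * real n powr (1 - p)) powr (1 / p)"
      using assms by (intro powr_mono2 sum_nonneg) simp_all
    also have "\<dots> = C3 powr (1 / p) * real n powr (1 / p - 1)"
      using assms C3 by (simp add: powr_mult powr_powr diff_divide_distrib left_diff_distrib)
    finally show ?thesis
      by (subst schatten_finite(2)) simp_all
  qed
  show "multiplier_norm ?I p chi \<le> ennreal (C3 powr (1 / p) * real n powr (1 / p - 1))"
    unfolding multiplier_norm_def
  proof (rule SUP_least)
    fix B assume "B \<in> {B \<in> schatten ?I p. schatten_norm ?I p B \<le> 1}"
    then have "schatten_norm ?I p B \<le> 1" by blast
    then show "(if chi \<star> B \<in> schatten ?I p then ennreal (schatten_norm ?I p (chi \<star> B)) else \<infinity>)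
        \<le> ennreal (C3 powr (1 / p) * real n powr (1 / p - 1))"
      using schatten_finite(1)[of ?I "chi \<star> B" p] bound[of B] by (simp add: ennreal_leI)
  qed
qed

theorem theorem6p1:
  fixes p :: real
  assumes "0 < p" and "p < 1"
  shows "\<exists>c C :: real. 0 < c \<and> 0 < C \<and>
    (\<forall>n::nat. 1 \<le> n \<longrightarrow>
       ennreal (c * real n powr (1 / p - 1)) \<le> multiplier_norm {1..n} p chi \<and>
       multiplier_norm {1..n} p chi = multiplier_norm UNIV p (Delta n) \<and>
       multiplier_norm UNIV p (Delta n) \<le> ennreal (C * real n powr (1 / p - 1)))"
proof -
  obtain C where "0 < C"
    "\<And>n. 1 \<le> n \<Longrightarrow> multiplier_norm {1..n} p chi \<le> ennreal (C * real n powr (1 / p - 1))"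
    using multiplier_norm_chi_le[OF assms] by blast
  then show ?thesis
    using multiplier_norm_chi_ge[OF assms(1)] multiplier_norm_Delta_eq_chi[OF assms(1)]
    by (intro exI[of _ "1 / 2"] exI[of _ C]) simp
qed

end
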